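(* Let $A$ be a $C^*$-algebra and let $I \subseteq A$ be a (two-sided, not necessarily norm-closed) ideal. Then the following are equivalent: (1) $I$ is semiprime. (2) $I$ is idempotent, that is, $I^2 = I$, which means that for every $x \in I$ there exist $n \geq 1$ and $y_1,\ldots,y_n,z_1,\ldots,z_n \in I$ such that $x = y_1z_1 + \ldots + y_nz_n$. (3) $I^m = I^n$ for some integers $m,n \geq 1$ with $m \neq n$. (4) $I$ factors, that is, for every $x \in I$ there exist $y,z \in I$ such that $x = yz$. (5) $I$ is closed under (square or arbitrary) roots of positive elements. (Here both versions of the condition are equivalent to (1)--(4): the version for square roots, that $a^{1/2} \in I$ for every $a \in I \cap A_+$; and the version for arbitrary roots, that $a^{1/n} \in I$ for every $a \in I \cap A_+$ and every integer $n \geq 1$.)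
   Context: $C^*$-algebras are not assumed unital, and $A_+$ denotes the set of positive elements of $A$. An ideal in a $C^*$-algebra $A$ is an additive subgroup $I \subseteq A$ with $aI \cup Ia \subseteq I$ for all $a \in A$; it need not be norm-closed, self-adjoint, or closed under multiplication by complex scalars. For ideals $I,J$, the product $IJ$ is the additive subgroup generated by $\{xy : x \in I, y \in J\}$, and $I^n$ is the additive subgroup generated by $\{x_1\cdots x_n : x_1,\ldots,x_n \in I\}$ (so $I^1 = I$). An ideal $I$ is semiprime if for all ideals $J \subseteq A$, $J^2 \subseteq I$ implies $J \subseteq I$. *)

theory Defs
  imports "HOL-Analysis.Analysis" "HOL-Computational_Algebra.Group_Closure"
begin

class scaleC =
  fixes scaleC :: "complex \<Rightarrow> 'a \<Rightarrow> 'a"  (infixr \<open>*\<^sub>C\<close> 75)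

class involution =
  fixes adj :: "'a \<Rightarrow> 'a"

(* No unit is required: real_normed_algebra and banach provide a complete, submultiplicative
   norm on a possibly non-unital ring, and the zero algebra is included. *)
class cstar_algebra = real_normed_algebra + banach + scaleC + involution +
  assumes scaleC_add_right: "c *\<^sub>C (x + y) = c *\<^sub>C x + c *\<^sub>C y"
    and scaleC_add_left: "(c + d) *\<^sub>C x = c *\<^sub>C x + d *\<^sub>C x"
    and scaleC_scaleC: "c *\<^sub>C (d *\<^sub>C x) = (c * d) *\<^sub>C x"
    and scaleC_of_real: "complex_of_real r *\<^sub>C x = r *\<^sub>R x"
    and mult_scaleC_left: "(c *\<^sub>C x) * y = c *\<^sub>C (x * y)"
    and mult_scaleC_right: "x * (c *\<^sub>C y) = c *\<^sub>C (x * y)"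
    and norm_scaleC: "norm (c *\<^sub>C x) = cmod c * norm x"
    and adj_adj: "adj (adj x) = x"
    and adj_add: "adj (x + y) = adj x + adj y"
    and adj_scaleC: "adj (c *\<^sub>C x) = cnj c *\<^sub>C adj x"
    and adj_mult: "adj (x * y) = adj y * adj x"
    and cstar_identity: "norm (adj x * x) = (norm x)\<^sup>2"

(* The pair (a, c) stands for a + c1 in the minimal unitization, whose unit is (0, 1). *)
definition unitization_mult ::
    "'a::cstar_algebra \<times> complex \<Rightarrow> 'a \<times> complex \<Rightarrow> 'a \<times> complex" where
  "unitization_mult u v =
     (fst u * fst v + snd v *\<^sub>C fst u + snd u *\<^sub>C fst v, snd u * snd v)"

(* Always relative to the unitization, so 0 belongs to the spectrum of every element, also when
   the algebra has a unit; this does not affect whether the spectrum is nonnegative. *)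
definition spectrum :: "'a::cstar_algebra \<Rightarrow> complex set" where
  "spectrum a = {z. \<not> (\<exists>u. unitization_mult (a, - z) u = (0, 1) \<and>
                          unitization_mult u (a, - z) = (0, 1))}"

definition positive_elements :: "'a::cstar_algebra set" where
  "positive_elements = {a. adj a = a \<and> spectrum a \<subseteq> complex_of_real ` {0..}}"

(* Products of nonempty lists: there is no unit to serve as the empty product, so the value at
   the empty list is arbitrary. *)
fun nonempty_prod :: "'a::semiring_0 list \<Rightarrow> 'a" where
  "nonempty_prod [] = 0"
| "nonempty_prod [x] = x"
| "nonempty_prod (x # y # ys) = x * nonempty_prod (y # ys)"

(* For n \<ge> 1, a positive element a has exactly one positive n-th root, and this is the value
   at a of the continuous functional calculus for the real n-th root. *)
definition positive_root :: "nat \<Rightarrow> 'a::cstar_algebra \<Rightarrow> 'a" where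
  "positive_root n a = (THE b. b \<in> positive_elements \<and> nonempty_prod (replicate n b) = a)"

definition two_sided_ideal :: "'a::ring set \<Rightarrow> bool" where
  "two_sided_ideal I \<longleftrightarrow>
     0 \<in> I \<and> (\<forall>x\<in>I. \<forall>y\<in>I. x - y \<in> I) \<and> (\<forall>a. \<forall>x\<in>I. a * x \<in> I \<and> x * a \<in> I)"

(* Only meaningful for n \<ge> 1. *)
definition ideal_power :: "'a::ring set \<Rightarrow> nat \<Rightarrow> 'a set" where
  "ideal_power I n = group_closure {nonempty_prod xs | xs. length xs = n \<and> set xs \<subseteq> I}"

definition semiprime_ideal :: "'a::ring set \<Rightarrow> bool" where
  "semiprime_ideal I \<longleftrightarrow>
     two_sided_ideal I \<and> (\<forall>J. two_sided_ideal J \<longrightarrow> ideal_power J 2 \<subseteq> I \<longrightarrow> J \<subseteq> I)"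

end

theory Submission
  imports Defs "HOL-Computational_Algebra.Fundamental_Theorem_Algebra"
begin

text \<open>
  All six conditions are compared with the condition that \<open>b\<^sup>N \<in> I\<close> implies \<open>b \<in> I\<close> for positive \<open>b\<close>.
  If it holds and \<open>x\<^sup>* x = b\<^sup>8\<close> with some power of \<open>b\<close> in \<open>I\<close>, then \<open>b \<in> I\<close>, and \<open>x = v b\<^sup>2 = (v b) b\<close> with
  both factors in \<open>I\<close>; this gives the factorization property and semiprimeness. Conversely, it suffices
  that \<open>b\<^sup>4 \<in> I\<close> implies \<open>b\<^sup>3 \<in> I\<close>.

  The analytic key is that \<open>b\<^sup>k x b\<^sup>m \<in> b\<^sup>l A + A b\<^sup>l\<close> whenever \<open>k + m > l\<close>: a Sylvester type equation is
  solved by a series that converges since \<open>\<parallel>b\<^sup>k (1 - b\<^sup>l)\<^sup>n\<parallel>\<close> is of order \<open>n\<close> to the power \<open>- k / l\<close>. For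
  semiprime \<open>I\<close> and \<open>b\<^sup>4 \<in> I\<close> it shows \<open>b\<^sup>3 A b\<^sup>3 \<subseteq> I\<close>, whence \<open>b\<^sup>3 \<in> I\<close>. For idempotent \<open>I\<close> and
  \<open>p, q, r \<in> I\<close> it writes \<open>p q r\<close> as an element of the ideal generated by \<open>c = p\<^sup>* p + q\<^sup>* q + r\<^sup>* r\<close>, so
  that \<open>I = I\<^sup>3\<close> is self-adjoint. Then \<open>b\<^sup>4 = \<Sum> y\<^sub>i z\<^sub>i\<close> is dominated by \<open>h = g\<^bsup>12\<^esup>\<close>, the sum of the
  \<open>y\<^sub>i y\<^sub>i\<^sup>* + z\<^sub>i\<^sup>* z\<^sub>i\<close>, dividing by \<open>g\<^sup>5\<close> gives \<open>g\<^sup>7 \<in> I\<close>, and \<open>b\<^sup>2 \<in> A g\<^sup>5\<close>, \<open>b \<in> A g\<^sup>2\<close> yield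
  \<open>b\<^sup>3 \<in> A g\<^sup>7 A\<close>. Since \<open>I\<close> need not be closed under scalars, normalizing factors are always moved
  into elements of \<open>A\<close>.
\<close>

section \<open>The unitization\<close>

lemma norm_adj: "norm (adj x) = norm (x :: 'a::cstar_algebra)"
proof -
  have *: "norm y \<le> norm (adj y)" for y :: 'a
  proof (cases "y = 0")
    case False
    have "(norm y)\<^sup>2 \<le> norm (adj y) * norm y"
      using norm_mult_ineq[of "adj y" y] by (simp add: cstar_identity)
    then show ?thesis using False by (simp add: power2_eq_square)
  qed simp
  show ?thesis using *[of x] *[of "adj x"] by (simp add: adj_adj)
qed

lemma adj_zero [simp]: "adj (0 :: 'a::cstar_algebra) = 0"
  using norm_adj[of "0::'a"] by simp

lemma adj_minus [simp]: "adj (- x) = - adj (x :: 'a::cstar_algebra)"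
  using adj_add[of x "- x"] by (simp add: eq_neg_iff_add_eq_0 add.commute)

lemma adj_diff: "adj (x - y) = adj x - adj (y :: 'a::cstar_algebra)"
  using adj_add[of x "- y"] by simp

lemma adj_sum: "adj (\<Sum>i\<in>S. f i) = (\<Sum>i\<in>S. adj (f i :: 'a::cstar_algebra))"
  by (induction S rule: infinite_finite_induct) (auto simp: adj_add)

lemma adj_scaleR: "adj (r *\<^sub>R x) = r *\<^sub>R adj (x :: 'a::cstar_algebra)"
  by (metis adj_scaleC complex_cnj_complex_of_real scaleC_of_real)

lemma bounded_linear_adj: "bounded_linear (adj :: 'a::cstar_algebra \<Rightarrow> 'a)"
  by (rule bounded_linear_intro[where K = 1]) (simp_all add: adj_add adj_scaleR norm_adj)

lemma scaleC_zero_left [simp]: "0 *\<^sub>C x = (0 :: 'a::cstar_algebra)"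
  using norm_scaleC[of 0 x] by simp

lemma scaleC_zero_right [simp]: "c *\<^sub>C 0 = (0 :: 'a::cstar_algebra)"
  using norm_scaleC[of c "0::'a"] by simp

lemma scaleC_one [simp]: "1 *\<^sub>C x = (x :: 'a::cstar_algebra)"
  using scaleC_of_real[of 1 x] by simp

lemma scaleC_minus_left [simp]: "(- c) *\<^sub>C x = - (c *\<^sub>C (x :: 'a::cstar_algebra))"
  using scaleC_add_left[of c "- c" x] by (simp add: eq_neg_iff_add_eq_0 add.commute)

lemma scaleC_minus_right [simp]: "c *\<^sub>C (- x) = - (c *\<^sub>C (x :: 'a::cstar_algebra))"
  using scaleC_add_right[of c x "- x"] by (simp add: eq_neg_iff_add_eq_0 add.commute)

lemma scaleC_diff_left: "(c - d) *\<^sub>C x = c *\<^sub>C x - d *\<^sub>C (x :: 'a::cstar_algebra)"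
  using scaleC_add_left[of c "- d" x] by simp

lemma scaleC_diff_right: "c *\<^sub>C (x - y) = c *\<^sub>C x - c *\<^sub>C (y :: 'a::cstar_algebra)"
  using scaleC_add_right[of c x "- y"] by simp

lemma scaleC_scaleR: "c *\<^sub>C (r *\<^sub>R x) = r *\<^sub>R (c *\<^sub>C (x :: 'a::cstar_algebra))"
  by (metis mult.commute scaleC_of_real scaleC_scaleC)

lemma scaleR_scaleC: "(r *\<^sub>R c) *\<^sub>C x = r *\<^sub>R (c *\<^sub>C (x :: 'a::cstar_algebra))"
  by (simp add: scaleR_conv_of_real scaleC_of_real[symmetric] scaleC_scaleC)

lemma bounded_linear_scaleC: "bounded_linear (\<lambda>x :: 'a::cstar_algebra. c *\<^sub>C x)"
  by (rule bounded_linear_intro[where K = "cmod c"])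
    (simp_all add: scaleC_add_right scaleC_scaleR norm_scaleC)

section \<open>Norm and completeness of the unitization\<close>

datatype 'a unitization = Unitization (alg_part: 'a) (scalar_part: complex)

text \<open>Left multiplication by the formal sum \<open>a + c1\<close>, restricted to the algebra,
  which is an ideal of its unitization.\<close>

definition left_action :: "'a::cstar_algebra unitization \<Rightarrow> 'a \<Rightarrow> 'a" where
  "left_action u x = alg_part u * x + scalar_part u *\<^sub>C x"

lemma bounded_linear_left_action: "bounded_linear (left_action u)"
  unfolding left_action_def
  by (intro bounded_linear_add bounded_linear_mult_right bounded_linear_scaleC)

instantiation unitization :: (cstar_algebra) "{real_normed_algebra, scaleC, involution}"
begin

definition "0 = Unitization 0 0"
definition "u + v = Unitization (alg_part u + alg_part v) (scalar_part u + scalar_part v)"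
definition "- u = Unitization (- alg_part u) (- scalar_part u)"
definition "u - v = Unitization (alg_part u - alg_part v) (scalar_part u - scalar_part v)"
definition "u * v = Unitization
  (alg_part u * alg_part v + scalar_part v *\<^sub>C alg_part u + scalar_part u *\<^sub>C alg_part v)
  (scalar_part u * scalar_part v)"
definition "r *\<^sub>R u = Unitization (r *\<^sub>R alg_part u) (r *\<^sub>R scalar_part u)"
definition "c *\<^sub>C u = Unitization (c *\<^sub>C alg_part u) (c * scalar_part u)"
definition "adj u = Unitization (adj (alg_part u)) (cnj (scalar_part u))"
\<comment> \<open>If the algebra already has a unit, the operator norm of the left action is only a seminorm;
  the maximum with the modulus of the scalar part is a \<open>C\<^sup>*\<close>-norm in all cases.\<close>
definition "norm u = max (onorm (left_action u)) (cmod (scalar_part u))"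
definition "dist u v = norm (u - v)" for u v :: "'a unitization"
definition "sgn u = inverse (norm u) *\<^sub>R u" for u :: "'a unitization"
definition "(uniformity :: ('a unitization \<times> 'a unitization) filter) =
  (INF e\<in>{0<..}. principal {(x, y). dist x y < e})"
definition "open U \<longleftrightarrow> (\<forall>x\<in>U. \<forall>\<^sub>F (x', y) in uniformity. x' = x \<longrightarrow> y \<in> U)"
  for U :: "'a unitization set"

lemmas unitization_defs = zero_unitization_def plus_unitization_def uminus_unitization_def
  minus_unitization_def times_unitization_def scaleR_unitization_def scaleC_unitization_def
  adj_unitization_def

lemma left_action_mult: "left_action (u * v) x = left_action u (left_action v x)"
  by (simp add: left_action_def unitization_defs algebra_simps mult_scaleC_left mult_scaleC_right
      scaleC_add_right scaleC_scaleC)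

text \<open>For the algebra-valued inner product \<open>adj x * y\<close>, the left action of
  \<open>adj u\<close> is the adjoint of that of \<open>u\<close>; this is what turns the operator
  norm into a C*-norm.\<close>

lemma left_action_adj: "adj (left_action u x) * y = adj x * left_action (adj u) y"
  by (simp add: left_action_def unitization_defs algebra_simps adj_add adj_mult adj_scaleC
      mult_scaleC_left mult_scaleC_right mult.assoc)

lemma norm_left_action_le: "norm (left_action u x) \<le> norm u * norm x"
  using onorm[OF bounded_linear_left_action, of u x]
  by (rule order_trans) (simp add: norm_unitization_def mult_right_mono)

lemma norm_unitization_leI:
  assumes "0 \<le> b" "\<And>x. norm (left_action u x) \<le> b * norm x" "cmod (scalar_part u) \<le> b"
  shows "norm u \<le> b"
  using assms by (simp add: norm_unitization_def onorm_bound)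

lemma cmod_scalar_part_le: "cmod (scalar_part u) \<le> norm u"
  by (simp add: norm_unitization_def)

lemma norm_unitization_nonneg: "0 \<le> norm (u :: 'a unitization)"
  using cmod_scalar_part_le[of u] norm_ge_zero[of "scalar_part u"] by linarith

text \<open>Testing the action on \<open>adj a\<close>, where \<open>a * adj a\<close> has norm the
  square of that of \<open>a\<close>, recovers the algebra part up to a factor 2. Definiteness of
  the norm and completeness rest on this.\<close>

lemma norm_alg_part_le: "norm (alg_part u) \<le> 2 * norm u"
proof (cases "alg_part u = 0")
  case False
  define a where "a = alg_part u"
  have "norm (adj a) * norm a = norm (a * adj a)"
    using cstar_identity[of "adj a"] by (simp add: norm_adj adj_adj power2_eq_square)
  also have "a * adj a = left_action u (adj a) - scalar_part u *\<^sub>C adj a"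
    by (simp add: left_action_def a_def)
  also have "norm \<dots> \<le> norm u * norm (adj a) + norm u * norm (adj a)"
    by (intro order_trans[OF norm_triangle_ineq4] add_mono norm_left_action_le)
      (simp add: norm_scaleC mult_right_mono cmod_scalar_part_le)
  finally show ?thesis using False by (simp add: norm_adj a_def)
qed (simp add: norm_unitization_nonneg)

lemma norm_unitization_le: "norm u \<le> norm (alg_part u) + cmod (scalar_part u)"
  by (rule norm_unitization_leI)
    (auto simp: left_action_def norm_scaleC ring_distribs
      intro!: order_trans[OF norm_triangle_ineq] add_mono norm_mult_ineq)

lemma norm_unitization_mult: "norm (u * v) \<le> norm u * norm (v :: 'a unitization)"
proof (rule norm_unitization_leI)
  fix x
  have "norm (left_action (u * v) x) \<le> norm u * (norm v * norm x)"
    by (simp add: left_action_mult)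
      (meson norm_left_action_le norm_unitization_nonneg mult_left_mono order_trans)
  then show "norm (left_action (u * v) x) \<le> norm u * norm v * norm x" by (simp add: mult.assoc)
  show "cmod (scalar_part (u * v)) \<le> norm u * norm v"
    by (simp add: times_unitization_def norm_mult mult_mono cmod_scalar_part_le
        norm_unitization_nonneg)
qed (simp add: norm_unitization_nonneg)

lemma norm_unitization_square_le: "(norm u)\<^sup>2 \<le> norm (adj u * u :: 'a unitization)"
proof -
  have "norm u \<le> sqrt (norm (adj u * u))"
  proof (rule norm_unitization_leI)
    fix x
    have "(norm (left_action u x))\<^sup>2 = norm (adj x * left_action (adj u * u) x)"
      by (simp add: cstar_identity[symmetric] left_action_adj left_action_mult)
    also have "\<dots> \<le> norm x * (norm (adj u * u) * norm x)"
      by (intro order_trans[OF norm_mult_ineq])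
        (simp add: norm_adj mult_left_mono norm_left_action_le)
    also have "\<dots> = (sqrt (norm (adj u * u)) * norm x)\<^sup>2"
      by (simp add: power2_eq_square norm_unitization_nonneg)
    finally show "norm (left_action u x) \<le> sqrt (norm (adj u * u)) * norm x"
      by (rule power2_le_imp_le) (simp add: norm_unitization_nonneg)
    have "(cmod (scalar_part u))\<^sup>2 = cmod (scalar_part (adj u * u))"
      by (simp add: unitization_defs norm_mult power2_eq_square)
    also have "\<dots> \<le> norm (adj u * u)" by (rule cmod_scalar_part_le)
    finally show "cmod (scalar_part u) \<le> sqrt (norm (adj u * u))"
      by (simp add: real_le_rsqrt)
  qed (simp add: norm_unitization_nonneg)
  then have "(norm u)\<^sup>2 \<le> (sqrt (norm (adj u * u)))\<^sup>2"
    by (intro power_mono norm_unitization_nonneg)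
  then show ?thesis by (simp add: norm_unitization_nonneg)
qed

lemma norm_unitization_adj: "norm (adj u) = norm (u :: 'a unitization)"
proof -
  have *: "norm v \<le> norm (adj v)" for v :: "'a unitization"
  proof (cases "norm v = 0")
    case False
    have "norm v * norm v \<le> norm (adj v) * norm v"
      using norm_unitization_square_le[of v] norm_unitization_mult[of "adj v" v]
      by (simp add: power2_eq_square)
    then show ?thesis using False norm_unitization_nonneg[of v] by simp
  qed (simp add: norm_unitization_nonneg)
  have "adj (adj u) = u" by (simp add: unitization_defs adj_adj)
  then show ?thesis using *[of u] *[of "adj u"] by simp
qed

instance
proof
  fix u v w :: "'a unitization" and r s :: real and c d :: complex
  show "u + v + w = u + (v + w)" "u + v = v + u" "0 + u = u" "- u + u = 0" "u - v = u + - v"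
    "u * v * w = u * (v * w)" "(u + v) * w = u * w + v * w" "u * (v + w) = u * v + u * w"
    by (simp_all add: unitization_defs algebra_simps scaleC_add_left scaleC_add_right
        mult_scaleC_left mult_scaleC_right scaleC_scaleC)
  show "r *\<^sub>R (u + v) = r *\<^sub>R u + r *\<^sub>R v" "(r + s) *\<^sub>R u = r *\<^sub>R u + s *\<^sub>R u"
    "r *\<^sub>R s *\<^sub>R u = (r * s) *\<^sub>R u" "1 *\<^sub>R u = u" "r *\<^sub>R u * v = r *\<^sub>R (u * v)"
    "u * r *\<^sub>R v = r *\<^sub>R (u * v)"
    by (simp_all add: unitization_defs algebra_simps scaleC_scaleR scaleR_scaleC)
  show "dist u v = norm (u - v)" "sgn u = inverse (norm u) *\<^sub>R u"
    by (simp_all add: dist_unitization_def sgn_unitization_def)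
  show "(uniformity :: ('a unitization \<times> 'a unitization) filter) =
      (INF e\<in>{0<..}. principal {(x, y). dist x y < e})"
    by (simp add: uniformity_unitization_def)
  show "open U \<longleftrightarrow> (\<forall>x\<in>U. \<forall>\<^sub>F (x', y) in uniformity. x' = x \<longrightarrow> y \<in> U)"
    for U :: "'a unitization set"
    by (simp add: open_unitization_def)
  have la: "left_action (u + v) = (\<lambda>x. left_action u x + left_action v x)"
    "left_action (r *\<^sub>R u) = (\<lambda>x. r *\<^sub>R left_action u x)"
    by (simp_all add: left_action_def unitization_defs fun_eq_iff algebra_simps scaleC_add_left
        scaleR_scaleC)
  show "norm (u + v) \<le> norm u + norm v"
    unfolding norm_unitization_def la
    using onorm_triangle[OF bounded_linear_left_action[of u] bounded_linear_left_action[of v]]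
      norm_triangle_ineq[of "scalar_part u" "scalar_part v"]
    by (simp add: plus_unitization_def) linarith
  show "norm (r *\<^sub>R u) = \<bar>r\<bar> * norm u"
    unfolding norm_unitization_def la
    by (simp add: onorm_scaleR[OF bounded_linear_left_action] scaleR_unitization_def
        max_mult_distrib_left)
  show "norm u = 0 \<longleftrightarrow> u = 0"
  proof
    assume "norm u = 0"
    then have "alg_part u = 0" "scalar_part u = 0"
      using norm_alg_part_le[of u] cmod_scalar_part_le[of u] by simp_all
    then show "u = 0" by (metis unitization.collapse zero_unitization_def)
  next
    assume "u = 0"
    then show "norm u = 0"
      using norm_unitization_le[of u] norm_unitization_nonneg[of u]
      by (simp add: zero_unitization_def)
  qed
  show "norm (u * v) \<le> norm u * norm v" by (rule norm_unitization_mult)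
qed

end

text \<open>The norm is equivalent to the sum of the norms of the two parts, so completeness is
  inherited from the algebra and the complex numbers.\<close>

instance unitization :: (cstar_algebra) banach
proof
  fix X :: "nat \<Rightarrow> 'a unitization"
  assume X: "Cauchy X"
  have nd: "norm (alg_part u - alg_part v) \<le> 2 * dist u v"
    "norm (scalar_part u - scalar_part v) \<le> dist u v" for u v :: "'a unitization"
    using norm_alg_part_le[of "u - v"] cmod_scalar_part_le[of "u - v"]
    by (simp_all add: dist_unitization_def minus_unitization_def)
  have C1: "Cauchy (\<lambda>n. alg_part (X n))"
  proof (rule metric_CauchyI)
    fix e :: real assume "0 < e"
    then obtain M where M: "dist (X m) (X n) < e / 2" if "m \<ge> M" "n \<ge> M" for m n
      using metric_CauchyD[OF X, of "e / 2"] by auto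
    show "\<exists>M. \<forall>m\<ge>M. \<forall>n\<ge>M. dist (alg_part (X m)) (alg_part (X n)) < e"
    proof (intro exI[of _ M] allI impI)
      fix m n assume "M \<le> m" "M \<le> n"
      then show "dist (alg_part (X m)) (alg_part (X n)) < e"
        using M[of m n] nd(1)[of "X m" "X n"] by (simp add: dist_norm)
    qed
  qed
  have C2: "Cauchy (\<lambda>n. scalar_part (X n))"
  proof (rule metric_CauchyI)
    fix e :: real assume "0 < e"
    then obtain M where M: "dist (X m) (X n) < e" if "m \<ge> M" "n \<ge> M" for m n
      using metric_CauchyD[OF X, of e] by auto
    show "\<exists>M. \<forall>m\<ge>M. \<forall>n\<ge>M. dist (scalar_part (X m)) (scalar_part (X n)) < e"
    proof (intro exI[of _ M] allI impI)
      fix m n assume "M \<le> m" "M \<le> n"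
      then show "dist (scalar_part (X m)) (scalar_part (X n)) < e"
        using M[of m n] nd(2)[of "X m" "X n"] by (simp add: dist_norm)
    qed
  qed
  from C1 C2 obtain a c where l: "(\<lambda>n. alg_part (X n)) \<longlonglongrightarrow> a" "(\<lambda>n. scalar_part (X n)) \<longlonglongrightarrow> c"
    by (meson Cauchy_convergent convergent_def)
  have "(\<lambda>n. norm (alg_part (X n) - a) + norm (scalar_part (X n) - c)) \<longlonglongrightarrow> 0 + 0"
    using l by (intro tendsto_add tendsto_norm_zero) (simp_all add: LIM_zero)
  then have l0: "(\<lambda>n. norm (alg_part (X n) - a) + norm (scalar_part (X n) - c)) \<longlonglongrightarrow> 0"
    by simp
  have "\<forall>n. norm (dist (X n) (Unitization a c)) \<le>
      norm (alg_part (X n) - a) + norm (scalar_part (X n) - c)"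
  proof
    fix n
    show "norm (dist (X n) (Unitization a c)) \<le>
        norm (alg_part (X n) - a) + norm (scalar_part (X n) - c)"
      using norm_unitization_le[of "X n - Unitization a c"]
      by (simp add: dist_norm minus_unitization_def)
  qed
  then have "(\<lambda>n. dist (X n) (Unitization a c)) \<longlonglongrightarrow> 0"
    by (intro Lim_null_comparison[OF always_eventually l0])
  then show "convergent X" using tendsto_dist_iff convergent_def by blast
qed

instance unitization :: (cstar_algebra) cstar_algebra
proof
  fix u v w :: "'a unitization" and r s :: real and c d :: complex
  show "c *\<^sub>C (u + v) = c *\<^sub>C u + c *\<^sub>C v" "(c + d) *\<^sub>C u = c *\<^sub>C u + d *\<^sub>C u"
    "c *\<^sub>C d *\<^sub>C u = (c * d) *\<^sub>C u" "complex_of_real r *\<^sub>C u = r *\<^sub>R u"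
    "(c *\<^sub>C u) * v = c *\<^sub>C (u * v)" "u * (c *\<^sub>C v) = c *\<^sub>C (u * v)"
    by (simp_all add: unitization_defs algebra_simps scaleC_add_left scaleC_add_right
        mult_scaleC_left mult_scaleC_right scaleC_scaleC scaleC_of_real scaleR_conv_of_real)
  show "norm (c *\<^sub>C u) = cmod c * norm u"
  proof (rule antisym)
    have *: "norm (c *\<^sub>C u) \<le> cmod c * norm u" for c and u :: "'a unitization"
    proof (rule norm_unitization_leI)
      fix x
      have "left_action (c *\<^sub>C u) x = c *\<^sub>C left_action u x"
        by (simp add: left_action_def scaleC_unitization_def mult_scaleC_left scaleC_add_right
            scaleC_scaleC)
      then show "norm (left_action (c *\<^sub>C u) x) \<le> cmod c * norm u * norm x"
        by (simp add: norm_scaleC mult_left_mono norm_left_action_le mult.assoc)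
      show "cmod (scalar_part (c *\<^sub>C u)) \<le> cmod c * norm u"
        by (simp add: scaleC_unitization_def norm_mult mult_left_mono cmod_scalar_part_le)
    qed (simp add: norm_unitization_nonneg)
    show "norm (c *\<^sub>C u) \<le> cmod c * norm u" by (rule *)
    show "cmod c * norm u \<le> norm (c *\<^sub>C u)"
    proof (cases "c = 0")
      case False
      then have "u = inverse c *\<^sub>C c *\<^sub>C u"
        by (simp add: scaleC_unitization_def scaleC_scaleC mult.assoc[symmetric])
      then have "norm u \<le> cmod (inverse c) * norm (c *\<^sub>C u)" using * by metis
      then show ?thesis using False by (simp add: norm_inverse inverse_eq_divide field_simps norm_divide)
    qed (simp add: norm_unitization_nonneg)
  qed
  show "adj (adj u) = u" "adj (u + v) = adj u + adj v" "adj (c *\<^sub>C u) = cnj c *\<^sub>C adj u"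
    "adj (u * v) = adj v * adj u"
    by (simp_all add: unitization_defs algebra_simps adj_adj adj_add adj_scaleC adj_mult)
  show "norm (adj u * u) = (norm u)\<^sup>2"
    using norm_unitization_square_le[of u] norm_unitization_mult[of "adj u" u]
    by (simp add: norm_unitization_adj power2_eq_square)
qed

instantiation unitization :: (cstar_algebra) real_normed_algebra_1
begin

definition "1 = Unitization 0 1"

instance
proof
  fix u :: "'a unitization"
  show "1 * u = u" "u * 1 = u" "(0 :: 'a unitization) \<noteq> 1"
    by (simp_all add: one_unitization_def times_unitization_def zero_unitization_def)
  show "norm (1 :: 'a unitization) = 1"
  proof (rule antisym)
    show "norm (1 :: 'a unitization) \<le> 1"
      using norm_unitization_le[of "1 :: 'a unitization"] by (simp add: one_unitization_def)
    show "1 \<le> norm (1 :: 'a unitization)"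
      using cmod_scalar_part_le[of "1 :: 'a unitization"] by (simp add: one_unitization_def)
  qed
qed

end

section \<open>Spectral radius and real spectrum of self-adjoint elements\<close>

definition has_inverse :: "'a::monoid_mult \<Rightarrow> bool" where
  "has_inverse u \<longleftrightarrow> (\<exists>v. u * v = 1 \<and> v * u = 1)"

lemma has_inverseI: "u * v = 1 \<Longrightarrow> v * u = 1 \<Longrightarrow> has_inverse u"
  by (auto simp: has_inverse_def)

lemma has_inverse_mult: "has_inverse u \<Longrightarrow> has_inverse v \<Longrightarrow> has_inverse (u * v)"
  unfolding has_inverse_def by (metis mult.assoc mult_1_left)

lemma has_inverse_scaleC_iff:
  fixes u :: "'a::{cstar_algebra, real_normed_algebra_1}"
  assumes "c \<noteq> 0"
  shows "has_inverse (c *\<^sub>C u) \<longleftrightarrow> has_inverse u"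
proof -
  have *: "has_inverse (d *\<^sub>C w)" if "has_inverse w" "d \<noteq> 0" for d and w :: 'a
  proof -
    from that obtain v where "w * v = 1" "v * w = 1" by (auto simp: has_inverse_def)
    then show ?thesis using that(2)
      by (intro has_inverseI[of _ "inverse d *\<^sub>C v"])
        (simp_all add: mult_scaleC_left mult_scaleC_right scaleC_scaleC)
  qed
  from *[of "c *\<^sub>C u" "inverse c"] *[of u c] assms show ?thesis by (auto simp: scaleC_scaleC)
qed

definition unital_spectrum :: "'a::{cstar_algebra, real_normed_algebra_1} \<Rightarrow> complex set" where
  "unital_spectrum u = {z. \<not> has_inverse (u - z *\<^sub>C 1)}"

lemma geometric_telescope:
  fixes x :: "'a::ring_1"
  shows "(1 - x) * (\<Sum>i<n. x ^ i) = 1 - x ^ n" "(\<Sum>i<n. x ^ i) * (1 - x) = 1 - x ^ n"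
proof -
  have "(1 - x) * (\<Sum>i<n. x ^ i) = 1 - x ^ n \<and> (\<Sum>i<n. x ^ i) * (1 - x) = 1 - x ^ n"
  proof (induction n)
    case (Suc n)
    then show ?case
      by (simp add: distrib_left distrib_right)
        (simp add: left_diff_distrib right_diff_distrib power_commutes)
  qed simp
  then show "(1 - x) * (\<Sum>i<n. x ^ i) = 1 - x ^ n" "(\<Sum>i<n. x ^ i) * (1 - x) = 1 - x ^ n"
    by simp_all
qed

text \<open>The Neumann series is the inverse; the geometric telescope is passed to the limit on
  both sides.\<close>

lemma has_inverse_one_minus:
  fixes x :: "'a::{real_normed_algebra_1, banach}"
  assumes "norm x < 1"
  shows "has_inverse (1 - x)"
proof -
  have "summable (\<lambda>n. norm (x ^ n))"
    by (rule summable_comparison_test[of _ "\<lambda>n. norm x ^ n"])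
      (use assms in \<open>auto simp: norm_power_ineq summable_geometric\<close>)
  then have s: "summable (\<lambda>n. x ^ n)" by (rule summable_norm_cancel)
  then have p: "(\<lambda>n. \<Sum>i<n. x ^ i) \<longlonglongrightarrow> suminf (\<lambda>n. x ^ n)" by (rule summable_LIMSEQ)
  have "(\<lambda>n. 1 - x ^ n) \<longlonglongrightarrow> 1 - 0"
    by (intro tendsto_intros summable_LIMSEQ_zero s)
  then have l: "(\<lambda>n. 1 - x ^ n) \<longlonglongrightarrow> 1" by simp
  show ?thesis
  proof (rule has_inverseI)
    show "(1 - x) * suminf (\<lambda>n. x ^ n) = 1"
      using tendsto_mult_left[OF p, of "1 - x"] l
      by (intro LIMSEQ_unique) (simp_all add: geometric_telescope)
    show "suminf (\<lambda>n. x ^ n) * (1 - x) = 1"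
      using tendsto_mult_right[OF p, of "1 - x"] l
      by (intro LIMSEQ_unique) (simp_all add: geometric_telescope)
  qed
qed

lemma cmod_le_norm_of_spectrum:
  assumes "z \<in> unital_spectrum u"
  shows "cmod z \<le> norm u"
proof (rule ccontr)
  assume n: "\<not> cmod z \<le> norm u"
  then have z: "z \<noteq> 0" by auto
  have "has_inverse (1 - inverse z *\<^sub>C u)"
    by (rule has_inverse_one_minus) (use n z in \<open>simp add: norm_scaleC norm_divide inverse_eq_divide field_simps\<close>)
  then have "has_inverse ((- z) *\<^sub>C (1 - inverse z *\<^sub>C u))"
    using z by (subst has_inverse_scaleC_iff) auto
  also have "(- z) *\<^sub>C (1 - inverse z *\<^sub>C u) = u - z *\<^sub>C 1"
    using z scaleC_add_right[of z 1 "- (inverse z *\<^sub>C u)"] by (simp add: scaleC_scaleC)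
  finally show False using assms by (simp add: unital_spectrum_def)
qed

lemma adj_one [simp]: "adj 1 = (1 :: 'a::{cstar_algebra, real_normed_algebra_1})"
  by (metis adj_adj adj_mult mult_1_left mult_1_right)

lemma adj_power: "adj (h ^ n) = adj (h :: 'a::{cstar_algebra, real_normed_algebra_1}) ^ n"
  by (induction n) (simp_all add: adj_mult power_commutes)

text \<open>Iterated C*-identity: squaring loses no norm, because each power is its own
  adjoint.\<close>

lemma norm_power_two_power:
  fixes h :: "'a::{cstar_algebra, real_normed_algebra_1}"
  assumes "adj h = h"
  shows "norm (h ^ 2 ^ m) = norm h ^ 2 ^ m"
proof (induction m)
  case (Suc m)
  have "h ^ 2 ^ Suc m = adj (h ^ 2 ^ m) * h ^ 2 ^ m"
    using assms by (simp add: adj_power power_add[symmetric] mult_2)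
  then show ?case using Suc by (simp add: cstar_identity power_mult[symmetric] mult.commute)
qed simp

text \<open>If the resolvent of a self-adjoint element of norm 1 existed on the whole closed unit disc, it
  would be bounded there. Averaging it over the \<open>2\<^sup>m\<close>-th roots of unity gives the inverses of
  \<open>1 - z\<^bsup>2^m\<^esup> h\<^bsup>2^m\<^esup>\<close> with a Lipschitz bound along radii independent of \<open>m\<close>, and this forces the
  powers \<open>h\<^bsup>2^m\<^esup>\<close> to tend to \<open>0\<close>, although they have norm 1.\<close>

lemma ex_unimodular_not_has_inverse:
  fixes h :: "'a::{cstar_algebra, real_normed_algebra_1}"
  assumes sa: "adj h = h" and n1: "norm h = 1"
  shows "\<exists>z. cmod z = 1 \<and> \<not> has_inverse (1 - z *\<^sub>C h)"
proof (rule ccontr)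
  assume contra: "\<not> ?thesis"
  have inv: "has_inverse (1 - z *\<^sub>C h)" if "cmod z \<le> 1" for z
  proof (cases "cmod z = 1")
    case False
    then show ?thesis using that n1 by (intro has_inverse_one_minus) (simp add: norm_scaleC)
  qed (use contra in auto)
  define g where "g z = (SOME v. (1 - z *\<^sub>C h) * v = 1 \<and> v * (1 - z *\<^sub>C h) = 1)" for z
  have g: "(1 - z *\<^sub>C h) * g z = 1" "g z * (1 - z *\<^sub>C h) = 1" if "cmod z \<le> 1" for z
    using someI_ex[OF inv[OF that, unfolded has_inverse_def]] by (auto simp: g_def)
  \<comment> \<open>The resolvent identity; together with compactness of the disc it gives the
    uniform bound \<open>K\<close>.\<close>
  have gdiff: "norm (g w - g z) \<le> cmod (w - z) * norm (g w) * norm (g z)"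
    if "cmod z \<le> 1" "cmod w \<le> 1" for z w
  proof -
    have "g w * ((w - z) *\<^sub>C h) * g z = g w * ((1 - z *\<^sub>C h) - (1 - w *\<^sub>C h)) * g z"
      by (simp add: scaleC_diff_left)
    also have "\<dots> = g w * ((1 - z *\<^sub>C h) * g z) - (g w * (1 - w *\<^sub>C h)) * g z"
      by (simp only: right_diff_distrib left_diff_distrib mult.assoc)
    also have "\<dots> = g w - g z" using g that by simp
    finally have "norm (g w - g z) = norm (g w * ((w - z) *\<^sub>C h) * g z)" by simp
    also have "\<dots> \<le> norm (g w) * norm ((w - z) *\<^sub>C h) * norm (g z)"
      by (meson norm_ge_zero norm_mult_ineq mult_right_mono order_trans)
    finally show ?thesis using n1 by (simp add: norm_scaleC mult_ac)
  qed
  obtain K where K: "\<And>z. cmod z \<le> 1 \<Longrightarrow> norm (g z) \<le> K"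
  proof (rule ccontr)
    assume "\<not> thesis"
    then have "\<forall>n::nat. \<exists>z. cmod z \<le> 1 \<and> norm (g z) > real n" using that by (meson not_le)
    then obtain zs where zs: "\<And>n. cmod (zs n) \<le> 1" "\<And>n. norm (g (zs n)) > real n" by metis
    have "\<forall>n. zs n \<in> cball 0 1" using zs by simp
    then obtain z r where z: "z \<in> cball 0 1" and r: "strict_mono r" and lim: "(zs \<circ> r) \<longlonglongrightarrow> z"
      using compact_cball[of "0::complex" 1] unfolding compact_def by blast
    have "(\<lambda>n. cmod (zs (r n) - z) * norm (g z)) \<longlonglongrightarrow> 0 * norm (g z)"
      using lim by (intro tendsto_mult tendsto_norm_zero tendsto_const) (simp add: LIM_zero o_def)
    then have "\<forall>\<^sub>F n in sequentially. cmod (zs (r n) - z) * norm (g z) < 1 / 2"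
      by (rule order_tendstoD) simp
    moreover obtain N where N: "2 * norm (g z) < real N" using reals_Archimedean2 by blast
    ultimately obtain n where n: "n \<ge> N" "cmod (zs (r n) - z) * norm (g z) < 1 / 2"
      unfolding eventually_sequentially by (meson max.cobounded1 max.cobounded2)
    \<comment> \<open>Once \<open>zs (r n)\<close> is near the limit \<open>z\<close>, the resolvent
      identity bounds the norm of \<open>g (zs (r n))\<close> by twice that of \<open>g z\<close>,
      although it was chosen larger than \<open>r n\<close>.\<close>
    have "norm (g (zs (r n)) - g z) \<le> (cmod (zs (r n) - z) * norm (g z)) * norm (g (zs (r n)))"
      using gdiff[of z "zs (r n)"] z zs by (simp add: mult_ac)
    also have "\<dots> \<le> 1 / 2 * norm (g (zs (r n)))" using n by (intro mult_right_mono) auto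
    finally have "norm (g (zs (r n))) \<le> 2 * norm (g z)"
      using norm_triangle_sub[of "g (zs (r n))" "g z"] by simp
    moreover have "real N < norm (g (zs (r n)))"
      using zs(2)[of "r n"] seq_suble[OF r, of n] n(1) by linarith
    ultimately show False using N by simp
  qed
  \<comment> \<open>The maximum with 1 keeps the radius \<open>s = 1 - 1 / (8 * L)\<close> chosen
    below nonnegative.\<close>
  define L where "L = max 1 (K * K)"
  have L: "1 \<le> L" by (simp add: L_def)
  have step: "\<exists>D. \<forall>z. cmod z \<le> 1 \<longrightarrow>
      (1 - z ^ 2 ^ m *\<^sub>C h ^ 2 ^ m) * D z = 1 \<and> D z * (1 - z ^ 2 ^ m *\<^sub>C h ^ 2 ^ m) = 1 \<and>
      (\<forall>s\<in>{0..1}. norm (D z - D (of_real s * z)) \<le> L * (1 - s))" for m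
  proof (induction m)
    case 0
    show ?case
    proof (intro exI[of _ g] allI impI conjI ballI)
      fix z :: complex and s :: real
      assume z: "cmod z \<le> 1" and s: "s \<in> {0..1}"
      have sz: "cmod (of_real s * z) \<le> 1" using z s by (simp add: norm_mult mult_le_one)
      have "z - of_real s * z = of_real (1 - s) * z" by (simp add: algebra_simps)
      then have "cmod (z - of_real s * z) = (1 - s) * cmod z"
        using s by (simp add: norm_mult del: of_real_diff)
      then have d: "cmod (z - of_real s * z) \<le> 1 - s" using s z by (simp add: mult_left_le)
      have "norm (g z - g (of_real s * z)) \<le> (1 - s) * K * K"
        by (rule order_trans[OF gdiff[OF sz z]], intro mult_mono K d z sz mult_nonneg_nonneg)
          (use s order_trans[OF norm_ge_zero K[OF z]] in auto)
      also have "\<dots> = K * K * (1 - s)" by (simp add: mult_ac)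
      also have "\<dots> \<le> L * (1 - s)" using s by (intro mult_right_mono) (auto simp: L_def)
      finally show "norm (g z - g (of_real s * z)) \<le> L * (1 - s)" .
    qed (use g in auto)
  next
    case (Suc m)
    then obtain D where D: "\<And>z. cmod z \<le> 1 \<Longrightarrow> (1 - z ^ 2 ^ m *\<^sub>C h ^ 2 ^ m) * D z = 1"
      "\<And>z. cmod z \<le> 1 \<Longrightarrow> D z * (1 - z ^ 2 ^ m *\<^sub>C h ^ 2 ^ m) = 1"
      "\<And>z s. cmod z \<le> 1 \<Longrightarrow> s \<in> {0..1} \<Longrightarrow> norm (D z - D (of_real s * z)) \<le> L * (1 - s)" by metis
    \<comment> \<open>Since \<open>\<omega>^(2^m) = -1\<close>, the elements \<open>D z\<close> and
      \<open>D (\<omega> * z)\<close> invert \<open>1 - A\<close> and \<open>1 + A\<close>, where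
      \<open>A = z^(2^m) h^(2^m)\<close>. Multiplied by \<open>1 - A * A\<close> they give
      \<open>1 + A\<close> and \<open>1 - A\<close>, whose average is 1.\<close>
    define \<omega> where "\<omega> = cis (pi / 2 ^ m)"
    have \<omega>: "\<omega> ^ 2 ^ m = -1" "cmod \<omega> = 1" by (simp_all add: \<omega>_def Complex.DeMoivre)
    define E where "E z = (1 / 2) *\<^sub>R (D z + D (\<omega> * z))" for z
    show ?case
    proof (intro exI[of _ E] allI impI conjI ballI)
      fix z :: complex and s :: real
      assume z: "cmod z \<le> 1"
      then have \<omega>z: "cmod (\<omega> * z) \<le> 1" by (simp add: norm_mult \<omega>)
      define A where "A = z ^ 2 ^ m *\<^sub>C h ^ 2 ^ m"
      have A': "(\<omega> * z) ^ 2 ^ m *\<^sub>C h ^ 2 ^ m = - A" by (simp add: A_def power_mult_distrib \<omega>)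
      have A2: "z ^ 2 ^ Suc m *\<^sub>C h ^ 2 ^ Suc m = A * A"
        by (simp add: A_def mult_2 power_add mult_scaleC_left mult_scaleC_right scaleC_scaleC)
      note d = D(1)[OF z, folded A_def] D(2)[OF z, folded A_def]
        D(1)[OF \<omega>z, unfolded A'] D(2)[OF \<omega>z, unfolded A']
      have "(1 - A * A) * D z = (1 + A) * ((1 - A) * D z)"
        "(1 - A * A) * D (\<omega> * z) = (1 - A) * ((1 - - A) * D (\<omega> * z))"
        "D z * (1 - A * A) = (D z * (1 - A)) * (1 + A)"
        "D (\<omega> * z) * (1 - A * A) = (D (\<omega> * z) * (1 - - A)) * (1 - A)"
        by (simp_all add: algebra_simps)
      then have e: "(1 - A * A) * D z = 1 + A" "(1 - A * A) * D (\<omega> * z) = 1 - A"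
        "D z * (1 - A * A) = 1 + A" "D (\<omega> * z) * (1 - A * A) = 1 - A"
        by (simp_all only: d mult_1_left mult_1_right)
      have two: "(1 / 2) *\<^sub>R (1 + 1) = (1 :: 'a)" by (rule scaleR_half_double)
      show "(1 - z ^ 2 ^ Suc m *\<^sub>C h ^ 2 ^ Suc m) * E z = 1"
        unfolding A2 E_def mult_scaleR_right distrib_left e using two by simp
      show "E z * (1 - z ^ 2 ^ Suc m *\<^sub>C h ^ 2 ^ Suc m) = 1"
        unfolding A2 E_def mult_scaleR_left distrib_right e using two by simp
      assume s: "s \<in> {0..1}"
      have "E z - E (of_real s * z) = (1 / 2) *\<^sub>R
        ((D z - D (of_real s * z)) + (D (\<omega> * z) - D (of_real s * (\<omega> * z))))"
        by (simp add: E_def algebra_simps)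
      also have "norm \<dots> \<le> 1 / 2 * (L * (1 - s) + L * (1 - s))"
        by (simp only: norm_scaleR)
          (intro mult_mono order_trans[OF norm_triangle_ineq] add_mono D(3) z \<omega>z s, auto)
      finally show "norm (E z - E (of_real s * z)) \<le> L * (1 - s)" by simp
    qed
  qed
  \<comment> \<open>The radius is so close to 1 that the Lipschitz bound costs only 1/8, yet its
    power with exponent \<open>2^m\<close> becomes small for large \<open>m\<close>.\<close>
  define s where "s = 1 - 1 / (8 * L)"
  have s: "0 \<le> s" "s < 1" "L * (1 - s) = 1 / 8" using L by (auto simp: s_def field_simps)
  from s have "(\<lambda>n. s ^ n) \<longlonglongrightarrow> 0" by (intro LIMSEQ_realpow_zero)
  then have "\<forall>\<^sub>F n in sequentially. s ^ n < 1 / 9" by (rule order_tendstoD) simp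
  then obtain m where "s ^ m < 1 / 9" by (auto simp: eventually_sequentially)
  moreover have "s ^ 2 ^ m \<le> s ^ m" using s by (intro power_decreasing) (auto simp: less_imp_le)
  ultimately have sm: "s ^ 2 ^ m \<le> 1 / 9" by simp
  define H where "H = h ^ 2 ^ m"
  have nH: "norm H = 1" using norm_power_two_power[OF sa, of m] n1 by (simp add: H_def)
  obtain D where D: "\<And>z. cmod z \<le> 1 \<Longrightarrow> (1 - z ^ 2 ^ m *\<^sub>C H) * D z = 1"
      "\<And>z. cmod z \<le> 1 \<Longrightarrow> D z * (1 - z ^ 2 ^ m *\<^sub>C H) = 1"
      "\<And>z s. cmod z \<le> 1 \<Longrightarrow> s \<in> {0..1} \<Longrightarrow> norm (D z - D (of_real s * z)) \<le> L * (1 - s)"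
    using step[of m] unfolding H_def by metis
  define B where "B = of_real s ^ 2 ^ m *\<^sub>C H"
  have nB: "norm B \<le> 1 / 9" using s sm by (simp add: B_def norm_scaleC norm_power nH)
  have DB: "D (of_real s) - 1 = B * D (of_real s)"
    using D(1)[of "of_real s"] s by (simp add: B_def algebra_simps)
  have nDB: "norm (D (of_real s) - 1) \<le> 1 / 9 * norm (D (of_real s))"
    unfolding DB by (rule order_trans[OF norm_mult_ineq]) (intro mult_right_mono nB norm_ge_zero)
  moreover have "norm (D (of_real s)) \<le> norm (D (of_real s) - 1) + 1"
    using norm_triangle_ineq[of "D (of_real s) - 1" 1] by simp
  ultimately have "norm (D (of_real s) - 1) \<le> 1 / 8" by simp
  moreover have "norm (D 1 - D (of_real s)) \<le> 1 / 8" using D(3)[of 1 s] s by simp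
  ultimately have E: "norm (D 1 - 1) \<le> 1 / 4"
    using norm_triangle_ineq[of "D 1 - D (of_real s)" "D (of_real s) - 1"] by simp
  \<comment> \<open>\<open>D 1\<close> inverts \<open>1 - H\<close> and is within 1/4 of 1, so
    \<open>H\<close> would have norm at most 1/2 instead of 1.\<close>
  have "H = (D 1 - 1) * (1 - H)" using D(2)[of 1] by (simp add: algebra_simps)
  then have "norm H \<le> norm (D 1 - 1) * norm (1 - H)" by (metis norm_mult_ineq)
  also have "\<dots> \<le> 1 / 4 * (1 + norm H)"
    using norm_triangle_ineq4[of 1 H] by (intro mult_mono E) auto
  finally show False using nH by simp
qed

text \<open>After scaling to norm 1, the unimodular \<open>z\<close> found above corresponds to the
  spectral value \<open>norm h / z\<close>, whose modulus is the norm of \<open>h\<close>: norm and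
  spectral radius agree.\<close>

lemma norm_le_of_spectrum:
  fixes h :: "'a::{cstar_algebra, real_normed_algebra_1}"
  assumes sa: "adj h = h" and r: "0 \<le> r" and sp: "\<And>z. z \<in> unital_spectrum h \<Longrightarrow> cmod z \<le> r"
  shows "norm h \<le> r"
proof (cases "h = 0")
  case False
  define k where "k = inverse (norm h) *\<^sub>R h"
  have "adj k = k" "norm k = 1" using False sa by (simp_all add: k_def adj_scaleR)
  then obtain z where z: "cmod z = 1" "\<not> has_inverse (1 - z *\<^sub>C k)"
    using ex_unimodular_not_has_inverse by blast
  define w where "w = of_real (norm h) / z"
  have w: "w \<noteq> 0" "cmod w = norm h" using z False by (auto simp: w_def norm_divide)
  have "(- w) *\<^sub>C (1 - z *\<^sub>C k) = h - w *\<^sub>C 1"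
    using z(1) False scaleC_add_right[of w 1 "- (z *\<^sub>C k)"]
    by (auto simp: k_def scaleC_scaleR scaleC_scaleC w_def scaleC_of_real)
  moreover have "\<not> has_inverse ((- w) *\<^sub>C (1 - z *\<^sub>C k))"
    using z(2) w by (subst has_inverse_scaleC_iff) auto
  ultimately have "w \<in> unital_spectrum h" by (simp add: unital_spectrum_def)
  from sp[OF this] w show ?thesis by simp
qed (use r in simp)

text \<open>Shifting by \<open>i t\<close> raises the bound for the squared modulus of a spectral
  value by \<open>t^2\<close> only, whereas the squared modulus itself gains
  \<open>t^2 + 2 * Im z * t\<close>. For large \<open>t\<close> of the right sign this is impossible
  unless \<open>Im z = 0\<close>.\<close>

lemma spectrum_self_adjoint_real:
  fixes h :: "'a::{cstar_algebra, real_normed_algebra_1}"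
  assumes sa: "adj h = h" and z: "z \<in> unital_spectrum h"
  shows "Im z = 0"
proof (rule ccontr)
  assume n: "Im z \<noteq> 0"
  have le: "(cmod (z + \<i> * of_real t))\<^sup>2 \<le> (norm h)\<^sup>2 + t\<^sup>2" for t
  proof -
    define u where "u = h + (\<i> * of_real t) *\<^sub>C 1"
    have "u - (z + \<i> * of_real t) *\<^sub>C 1 = h - z *\<^sub>C 1" by (simp add: u_def scaleC_add_left)
    then have "cmod (z + \<i> * of_real t) \<le> norm u"
      using z by (intro cmod_le_norm_of_spectrum) (simp add: unital_spectrum_def)
    then have "(cmod (z + \<i> * of_real t))\<^sup>2 \<le> (norm u)\<^sup>2" by (intro power_mono) auto
    also have "(norm u)\<^sup>2 = norm (adj u * u)" by (simp add: cstar_identity)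
    also have "adj u * u = h * h + (of_real (t * t)) *\<^sub>C 1"
      by (simp add: u_def adj_add adj_scaleC sa algebra_simps mult_scaleC_left mult_scaleC_right
          scaleC_scaleC scaleC_diff_right)
    also have "norm \<dots> \<le> norm (h * h) + t * t"
      by (rule order_trans[OF norm_triangle_ineq]) (simp add: norm_scaleC norm_mult del: of_real_mult)
    also have "\<dots> \<le> (norm h)\<^sup>2 + t\<^sup>2" using norm_mult_ineq[of h h] by (simp add: power2_eq_square)
    finally show ?thesis .
  qed
  have "(Re z)\<^sup>2 + (Im z)\<^sup>2 + 2 * Im z * t \<le> (norm h)\<^sup>2" for t
    using le[of t] by (simp add: cmod_power2 power2_sum algebra_simps)
  from this[of "((norm h)\<^sup>2 + 1) / (2 * Im z)"] n
  have "(Re z)\<^sup>2 + (Im z)\<^sup>2 + 1 \<le> 0" by simp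
  then show False using sum_power2_ge_zero[of "Re z" "Im z"] by linarith
qed

section \<open>Polynomial calculus and positivity\<close>

definition apply_cpoly :: "complex poly \<Rightarrow> 'a::{cstar_algebra, real_normed_algebra_1} \<Rightarrow> 'a" where
  "apply_cpoly p h = fold_coeffs (\<lambda>c y. c *\<^sub>C 1 + h * y) p 0"

text \<open>Real coefficients keep the values at a self-adjoint element self-adjoint; the complex
  version serves to split polynomials into linear factors.\<close>

definition apply_poly :: "real poly \<Rightarrow> 'a::{cstar_algebra, real_normed_algebra_1} \<Rightarrow> 'a" where
  "apply_poly p h = fold_coeffs (\<lambda>c y. c *\<^sub>R 1 + h * y) p 0"

lemma apply_cpoly_0 [simp]: "apply_cpoly 0 h = 0"
  by (simp add: apply_cpoly_def)

lemma apply_cpoly_pCons [simp]: "apply_cpoly (pCons c p) h = c *\<^sub>C 1 + h * apply_cpoly p h"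
  by (cases "p = 0 \<and> c = 0") (auto simp: apply_cpoly_def)

lemma apply_cpoly_add: "apply_cpoly (p + q) h = apply_cpoly p h + apply_cpoly q h"
  by (induction p q rule: poly_induct2) (simp_all add: algebra_simps scaleC_add_left)

lemma apply_cpoly_smult: "apply_cpoly (smult c p) h = c *\<^sub>C apply_cpoly p h"
  by (induction p) (simp_all add: scaleC_add_right scaleC_scaleC mult_scaleC_right)

lemma apply_poly_0 [simp]: "apply_poly 0 h = 0"
  by (simp add: apply_poly_def)

lemma apply_poly_pCons [simp]: "apply_poly (pCons c p) h = c *\<^sub>R 1 + h * apply_poly p h"
  by (cases "p = 0 \<and> c = 0") (auto simp: apply_poly_def)

lemma apply_poly_1 [simp]: "apply_poly 1 h = 1"
  by (simp add: one_pCons)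

lemma apply_poly_add: "apply_poly (p + q) h = apply_poly p h + apply_poly q h"
  by (induction p q rule: poly_induct2) (simp_all add: algebra_simps)

lemma apply_poly_smult: "apply_poly (smult c p) h = c *\<^sub>R apply_poly p h"
  by (induction p) (simp_all add: algebra_simps)

lemma apply_poly_diff: "apply_poly (p - q) h = apply_poly p h - apply_poly q h"
  using apply_poly_add[of p "- q" h] apply_poly_smult[of "-1" q h] by simp

lemma apply_poly_commute: "h * apply_poly p h = apply_poly p h * h"
proof (induction p)
  case (pCons c p)
  then have "h * (h * apply_poly p h) = h * (apply_poly p h * h)" by simp
  then show ?case by (simp add: distrib_left distrib_right mult.assoc)
qed simp

lemma apply_poly_mult: "apply_poly (p * q) h = apply_poly p h * apply_poly q h"
  by (induction p) (simp_all add: algebra_simps apply_poly_add apply_poly_smult mult.assoc)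

lemma apply_poly_power: "apply_poly (p ^ n) h = apply_poly p h ^ n"
  by (induction n) (simp_all add: apply_poly_mult)

lemma apply_poly_pcompose: "apply_poly (p \<circ>\<^sub>p q) h = apply_poly p (apply_poly q h)"
  by (induction p) (simp_all add: pcompose_pCons apply_poly_add apply_poly_mult)

lemma adj_apply_poly:
  assumes "adj h = h"
  shows "adj (apply_poly p h) = apply_poly p h"
  by (induction p) (simp_all add: adj_add adj_mult adj_scaleR assms apply_poly_commute)

lemma apply_cpoly_of_real: "apply_cpoly (map_poly of_real p) h = apply_poly p h"
  by (induction p) (simp_all add: map_poly_pCons scaleC_of_real)

lemma poly_map_poly_of_real:
  "poly (map_poly complex_of_real p) (of_real t) = of_real (poly p t)"
  by (induction p) (simp_all add: map_poly_pCons)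

text \<open>Split into linear factors by the fundamental theorem of algebra; each factor
  \<open>h - r\<close> is invertible because a root \<open>r\<close> is not spectral.\<close>

lemma has_inverse_apply_cpoly:
  assumes "p \<noteq> 0" "\<And>r. r \<in> unital_spectrum h \<Longrightarrow> poly p r \<noteq> 0"
  shows "has_inverse (apply_cpoly p h)"
  using assms
proof (induction "degree p" arbitrary: p)
  case 0
  then obtain c where c: "p = [:c:]" by (metis degree_eq_zeroE)
  then have "c \<noteq> 0" using 0 by simp
  then have "has_inverse (c *\<^sub>C (1 :: 'a))"
    by (subst has_inverse_scaleC_iff) (auto intro: has_inverseI[of _ 1])
  then show ?case by (simp add: c)
next
  case (Suc n)
  then have "\<not> constant (poly p)" by (simp add: constant_degree)
  then obtain r where r: "poly p r = 0" using fundamental_theorem_of_algebra by blast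
  then obtain q where q: "p = [:- r, 1:] * q" by (metis dvdE poly_eq_0_iff_dvd)
  then have "q \<noteq> 0" using Suc by auto
  then have "degree p = Suc (degree q)" by (simp add: q degree_mult_eq del: mult_pCons_left)
  then have "has_inverse (apply_cpoly q h)"
    using Suc \<open>q \<noteq> 0\<close> q by (intro Suc) auto
  moreover have "has_inverse (h - r *\<^sub>C 1)"
    using Suc.prems(2)[of r] r by (auto simp: unital_spectrum_def)
  moreover have "apply_cpoly p h = (h - r *\<^sub>C 1) * apply_cpoly q h"
    using apply_cpoly_add[of "smult (- r) q" "pCons 0 q" h] apply_cpoly_smult[of "- r" q h]
    by (simp add: q apply_cpoly_smult left_diff_distrib mult_scaleC_left)
  ultimately show ?case by (simp add: has_inverse_mult)
qed

text \<open>An empty spectrum would force norm 0 by the spectral radius bound, and then 0 is a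
  spectral value. This settles constant polynomials in the spectral mapping below.\<close>

lemma unital_spectrum_nonempty:
  fixes h :: "'a::{cstar_algebra, real_normed_algebra_1}"
  assumes "adj h = h"
  shows "unital_spectrum h \<noteq> {}"
proof
  assume e: "unital_spectrum h = {}"
  then have "norm h \<le> 0" using norm_le_of_spectrum[OF assms, of 0] by simp
  then have "0 \<in> unital_spectrum h" by (simp add: unital_spectrum_def has_inverse_def)
  then show False using e by simp
qed

text \<open>One half of spectral mapping: \<open>q - z\<close>, evaluated at \<open>h\<close>, is
  not invertible, so one of its roots is spectral.\<close>

lemma unital_spectrum_apply_poly:
  fixes h :: "'a::{cstar_algebra, real_normed_algebra_1}"
  assumes "adj h = h" and sp: "unital_spectrum h \<subseteq> of_real ` S"
    and z: "z \<in> unital_spectrum (apply_poly q h)"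
  shows "\<exists>t\<in>S. z = of_real (poly q t)"
proof -
  define P where "P = map_poly of_real q - [:z:]"
  have "apply_cpoly P h = apply_poly q h - z *\<^sub>C 1"
    using apply_cpoly_add[of P "[:z:]" h] by (simp add: P_def apply_cpoly_of_real)
  then have "\<not> has_inverse (apply_cpoly P h)" using z by (simp add: unital_spectrum_def)
  then have "\<exists>r\<in>unital_spectrum h. poly P r = 0"
  proof (cases "P = 0")
    case True
    then show ?thesis using unital_spectrum_nonempty[OF assms(1)] by auto
  qed (use has_inverse_apply_cpoly in blast)
  then obtain r where r: "r \<in> unital_spectrum h" "poly P r = 0" by auto
  then obtain t where t: "t \<in> S" "r = of_real t" using sp by auto
  have "z = of_real (poly q t)" using r by (simp add: P_def t poly_map_poly_of_real)
  then show ?thesis using t by blast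
qed

lemma unital_spectrum_self_adjoint:
  fixes h :: "'a::{cstar_algebra, real_normed_algebra_1}"
  assumes "adj h = h"
  shows "unital_spectrum h \<subseteq> of_real ` {- norm h..norm h}"
proof
  fix z assume z: "z \<in> unital_spectrum h"
  then have "z = of_real (Re z)" using spectrum_self_adjoint_real[OF assms] by (simp add: complex_eq_iff)
  moreover have "\<bar>Re z\<bar> \<le> norm h"
    using cmod_le_norm_of_spectrum[OF z] abs_Re_le_cmod[of z] by linarith
  ultimately show "z \<in> of_real ` {- norm h..norm h}" by (intro image_eqI[of _ _ "Re z"]) auto
qed

text \<open>The value is self-adjoint, so its norm is its spectral radius: the calculus is
  contractive for the supremum norm on any set covering the spectrum.\<close>

lemma norm_apply_poly_le:
  fixes h :: "'a::{cstar_algebra, real_normed_algebra_1}"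
  assumes "adj h = h" "unital_spectrum h \<subseteq> of_real ` S" "0 \<le> M"
    "\<And>t. t \<in> S \<Longrightarrow> \<bar>poly q t\<bar> \<le> M"
  shows "norm (apply_poly q h) \<le> M"
proof (rule norm_le_of_spectrum)
  fix z assume "z \<in> unital_spectrum (apply_poly q h)"
  then show "cmod z \<le> M" using unital_spectrum_apply_poly[OF assms(1,2)] assms(4) by fastforce
qed (use assms adj_apply_poly in auto)

section \<open>The cone of positive elements\<close>

definition pos :: "'a::{cstar_algebra, real_normed_algebra_1} \<Rightarrow> bool" where
  "pos a \<longleftrightarrow> adj a = a \<and> unital_spectrum a \<subseteq> of_real ` {0..}"

lemma unital_spectrum_diff_iff:
  "z \<in> unital_spectrum (r *\<^sub>R 1 - a) \<longleftrightarrow> of_real r - z \<in> unital_spectrum a"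
proof -
  have "(-1) *\<^sub>C (a - (of_real r - z) *\<^sub>C 1) = r *\<^sub>R 1 - a - z *\<^sub>C 1"
    by (simp add: scaleC_diff_left scaleC_of_real algebra_simps)
  moreover have "has_inverse ((-1) *\<^sub>C (a - (of_real r - z) *\<^sub>C 1)) \<longleftrightarrow>
      has_inverse (a - (of_real r - z) *\<^sub>C 1)"
    by (rule has_inverse_scaleC_iff) simp
  ultimately show ?thesis by (simp only: unital_spectrum_def mem_Collect_eq)
qed

text \<open>A real spectrum inside the disc of radius \<open>R\<close> about \<open>R\<close> is
  nonnegative. With the converse \<open>pos_norm_diff_le\<close> this describes positivity by a norm
  inequality, which is stable under sums and limits.\<close>

lemma posI:
  assumes "adj a = a" "norm (R *\<^sub>R 1 - a) \<le> R"
  shows "pos a"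
proof -
  have "z \<in> of_real ` {0..}" if z: "z \<in> unital_spectrum a" for z
  proof -
    have "Im z = 0" using spectrum_self_adjoint_real[OF assms(1) z] .
    have "of_real R - z \<in> unital_spectrum (R *\<^sub>R 1 - a)" using z by (simp add: unital_spectrum_diff_iff)
    then have "cmod (of_real R - z) \<le> R" using cmod_le_norm_of_spectrum assms(2) order_trans by blast
    then have "0 \<le> Re z" using abs_Re_le_cmod[of "of_real R - z"] by simp
    then show ?thesis using \<open>Im z = 0\<close> by (intro image_eqI[of _ _ "Re z"]) (auto simp: complex_eq_iff)
  qed
  then show ?thesis using assms by (auto simp: pos_def)
qed

lemma pos_adj: "pos a \<Longrightarrow> adj a = a"
  by (simp add: pos_def)

lemma pos_unital_spectrum:
  assumes "pos a"
  shows "unital_spectrum a \<subseteq> of_real ` {0..norm a}"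
proof
  fix z assume z: "z \<in> unital_spectrum a"
  then obtain t where "z = of_real t" "0 \<le> t" using assms by (auto simp: pos_def)
  then show "z \<in> of_real ` {0..norm a}" using cmod_le_norm_of_spectrum[OF z] by auto
qed

lemma pos_norm_diff_le:
  assumes a: "pos a" and R: "norm a \<le> R"
  shows "norm (R *\<^sub>R 1 - a) \<le> R"
proof -
  have "norm (apply_poly [:R, -1:] a) \<le> R"
    by (rule norm_apply_poly_le[OF pos_adj[OF a] pos_unital_spectrum[OF a]])
      (use R order_trans[OF norm_ge_zero R] in auto)
  then show ?thesis by simp
qed

lemma pos_zero: "pos 0"
  by (rule posI[of _ 0]) auto

lemma pos_add:
  assumes "pos a" "pos b"
  shows "pos (a + b)"
proof (rule posI)
  show "adj (a + b) = a + b" using assms by (simp add: adj_add pos_adj)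
  have "(norm a + norm b) *\<^sub>R 1 - (a + b) = (norm a *\<^sub>R 1 - a) + (norm b *\<^sub>R 1 - b)"
    by (simp add: algebra_simps)
  also have "norm \<dots> \<le> norm a + norm b"
    by (intro order_trans[OF norm_triangle_ineq] add_mono pos_norm_diff_le assms) auto
  finally show "norm ((norm a + norm b) *\<^sub>R 1 - (a + b)) \<le> norm a + norm b" .
qed

lemma pos_sum: "(\<And>i. i \<in> S \<Longrightarrow> pos (f i)) \<Longrightarrow> pos (\<Sum>i\<in>S. f i)"
  by (induction S rule: infinite_finite_induct) (auto simp: pos_zero pos_add)

lemma pos_apply_poly:
  assumes "adj h = h" "unital_spectrum h \<subseteq> of_real ` S" "\<And>t. t \<in> S \<Longrightarrow> 0 \<le> poly q t"
  shows "pos (apply_poly q h)"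
  unfolding pos_def
proof (intro conjI subsetI)
  fix z assume "z \<in> unital_spectrum (apply_poly q h)"
  then show "z \<in> of_real ` {0..}" using unital_spectrum_apply_poly[OF assms(1,2)] assms(3) by force
qed (use assms adj_apply_poly in auto)

lemma apply_poly_monom: "apply_poly (monom 1 n) h = h ^ n"
  by (induction n) (simp_all add: monom_Suc monom_0)

lemma pos_power:
  assumes "pos a"
  shows "pos (a ^ n)"
  using pos_apply_poly[OF pos_adj[OF assms] pos_unital_spectrum[OF assms], of "monom 1 n"]
  by (simp add: apply_poly_monom poly_monom)

lemma pos_scaleR:
  assumes "pos a" "0 \<le> r"
  shows "pos (r *\<^sub>R a)"
  using pos_apply_poly[OF pos_adj[OF assms(1)] pos_unital_spectrum[OF assms(1)], of "[:0, r:]"] assms(2)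
  by simp

lemma pos_square:
  assumes "adj h = h"
  shows "pos (h * h)"
  using pos_apply_poly[OF assms unital_spectrum_self_adjoint[OF assms], of "[:0, 0, 1:]"] by simp

lemma pos_limit:
  fixes X :: "nat \<Rightarrow> 'a::{cstar_algebra, real_normed_algebra_1}"
  assumes X: "\<And>n. pos (X n)" and lim: "X \<longlonglongrightarrow> a"
  shows "pos a"
proof -
  obtain R where R: "\<And>n. norm (X n) \<le> R"
    using convergent_imp_Bseq[of X] lim by (auto simp: convergent_def Bseq_def)
  have "(\<lambda>n. adj (X n)) \<longlonglongrightarrow> adj a" by (rule bounded_linear.tendsto[OF bounded_linear_adj lim])
  then have "adj a = a" using lim X LIMSEQ_unique by (simp add: pos_adj)
  moreover have "norm (R *\<^sub>R 1 - a) \<le> R"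
    by (rule Lim_bounded[of "\<lambda>n. norm (R *\<^sub>R 1 - X n)" _ 0])
      (auto intro!: tendsto_intros lim pos_norm_diff_le X R)
  ultimately show ?thesis by (rule posI)
qed

lemma pos_antisym:
  assumes "pos a" "pos (- a)"
  shows "a = 0"
proof -
  have "cmod z \<le> 0" if z: "z \<in> unital_spectrum a" for z
  proof -
    have "- z \<in> unital_spectrum (- a)" using z unital_spectrum_diff_iff[of "- z" 0 a] by simp
    then obtain s t where "z = of_real s" "0 \<le> s" "- z = of_real t" "0 \<le> t"
      using assms z by (force simp: pos_def)
    then show ?thesis by (simp add: complex_eq_iff)
  qed
  then show ?thesis using norm_le_of_spectrum[of a 0] pos_adj[OF assms(1)] by simp
qed

text \<open>Since \<open>q\<close> is at most \<open>norm q\<close> times the unit, so is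
  \<open>p\<close>, and this bounds the spectrum of \<open>p\<close>.\<close>

lemma pos_norm_mono:
  assumes p: "pos p" and qp: "pos (q - p)"
  shows "norm p \<le> norm q"
proof (rule norm_le_of_spectrum)
  have "pos q" using pos_add[OF p qp] by simp
  then have "pos (norm q *\<^sub>R 1 - q)"
    by (intro posI[of _ "norm q"]) (auto simp: adj_diff adj_scaleR pos_adj)
  from pos_add[OF this qp] have *: "pos (norm q *\<^sub>R 1 - p)" by simp
  fix z assume z: "z \<in> unital_spectrum p"
  then have "of_real (norm q) - z \<in> unital_spectrum (norm q *\<^sub>R 1 - p)"
    by (simp add: unital_spectrum_diff_iff)
  then obtain s t where s: "of_real (norm q) - z = of_real s" "0 \<le> s" and t: "z = of_real t" "0 \<le> t"
    using * p z by (force simp: pos_def)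
  have "norm q - t = s" using s(1) t(1) by (metis of_real_diff of_real_eq_iff)
  then show "cmod z \<le> norm q" using s t by simp
qed (use pos_adj[OF p] in auto)

text \<open>The inverse is \<open>1 + b * v * a\<close>, as the formal geometric series suggests.
  Consequently \<open>a * b\<close> and \<open>b * a\<close> have the same nonzero spectrum.\<close>

lemma has_inverse_one_minus_commute:
  fixes a b :: "'a::ring_1"
  assumes "has_inverse (1 - a * b)"
  shows "has_inverse (1 - b * a)"
proof -
  obtain v where v: "(1 - a * b) * v = 1" "v * (1 - a * b) = 1" using assms by (auto simp: has_inverse_def)
  have "(1 - b * a) * (1 + b * v * a) = 1 - b * a + b * ((1 - a * b) * v) * a"
    "(1 + b * v * a) * (1 - b * a) = 1 - b * a + b * (v * (1 - a * b)) * a"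
    by (simp_all add: algebra_simps)
  then show ?thesis by (intro has_inverseI[of _ "1 + b * v * a"]) (simp_all add: v)
qed

lemma unital_spectrum_mult_commute:
  fixes a b :: "'a::{cstar_algebra, real_normed_algebra_1}"
  assumes "z \<in> unital_spectrum (a * b)" "z \<noteq> 0"
  shows "z \<in> unital_spectrum (b * a)"
proof -
  have *: "has_inverse (c * d - z *\<^sub>C 1) \<longleftrightarrow> has_inverse (1 - (inverse z *\<^sub>C c) * d)" for c d :: 'a
  proof -
    have "(- z) *\<^sub>C (1 - (inverse z *\<^sub>C c) * d) = c * d - z *\<^sub>C 1"
      using assms(2) by (simp add: scaleC_diff_right mult_scaleC_left scaleC_scaleC)
    then show ?thesis using has_inverse_scaleC_iff[of "- z" "1 - (inverse z *\<^sub>C c) * d"] assms(2) by simp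
  qed
  show ?thesis
    using assms(1) has_inverse_one_minus_commute[of b "inverse z *\<^sub>C a"]
    by (auto simp: unital_spectrum_def * mult_scaleC_left mult_scaleC_right)
qed

section \<open>Uniform limits of polynomials and positive roots\<close>

lemma poly_approx_from_above:
  fixes f :: "real \<Rightarrow> real"
  assumes f: "continuous_on {l..u} f"
  shows "\<exists>Q. uniform_limit {l..u} (\<lambda>k. poly (Q k)) f sequentially \<and>
    (\<forall>k. \<forall>t\<in>{l..u}. f t \<le> poly (Q k) t)"
proof -
  have "\<exists>q. \<forall>t\<in>{l..u}. f t \<le> poly q t \<and> \<bar>f t - poly q t\<bar> < 2 / real (Suc k)" for k
  proof -
    obtain g where g: "real_polynomial_function g"
      "\<And>x. x \<in> {l..u} \<Longrightarrow> \<bar>f x - g x\<bar> < 1 / real (Suc k)"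
      by (rule Stone_Weierstrass_real_polynomial_function[OF compact_Icc f, of "1 / real (Suc k)"]) auto
    then obtain a n where a: "g = (\<lambda>x. \<Sum>i\<le>n. a i * x ^ i)"
      by (auto simp: real_polynomial_function_iff_sum)
    \<comment> \<open>Raising the Weierstrass approximation by its error bound makes it lie above
      \<open>f\<close>; for nonnegative \<open>f\<close> the approximants then give positive
      elements.\<close>
    define q where "q = (\<Sum>i\<le>n. monom (a i) i) + [:1 / real (Suc k):]"
    have "poly q t = g t + 1 / real (Suc k)" for t
      by (simp add: q_def a poly_sum poly_monom)
    moreover have "2 / real (Suc k) = 1 / real (Suc k) + 1 / real (Suc k)" by simp
    ultimately show ?thesis
      using g(2) by (intro exI[of _ q] ballI) (simp only: abs_less_iff, force)
  qed
  then obtain Q where Q: "\<And>k t. t \<in> {l..u} \<Longrightarrow> f t \<le> poly (Q k) t"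
    "\<And>k t. t \<in> {l..u} \<Longrightarrow> \<bar>f t - poly (Q k) t\<bar> < 2 / real (Suc k)" by metis
  have "uniform_limit {l..u} (\<lambda>k. poly (Q k)) f sequentially"
  proof (rule uniform_limitI)
    fix e :: real assume "0 < e"
    have "(\<lambda>k. 2 / real (Suc k)) \<longlonglongrightarrow> 0" by (rule LIMSEQ_Suc[OF lim_const_over_n])
    then have "\<forall>\<^sub>F k in sequentially. 2 / real (Suc k) < e" using \<open>0 < e\<close> by (rule order_tendstoD)
    then show "\<forall>\<^sub>F k in sequentially. \<forall>t\<in>{l..u}. dist (poly (Q k) t) (f t) < e"
    proof eventually_elim
      case (elim k)
      show ?case
      proof
        fix t assume "t \<in> {l..u}"
        from Q(2)[OF this, of k] elim show "dist (poly (Q k) t) (f t) < e"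
          by (simp only: dist_real_def abs_minus_commute)
      qed
    qed
  qed
  then show ?thesis using Q(1) by blast
qed

lemma apply_poly_limit_poly:
  fixes h :: "'a::{cstar_algebra, real_normed_algebra_1}"
  assumes "adj h = h" "unital_spectrum h \<subseteq> of_real ` S"
    and Q: "uniform_limit S (\<lambda>k. poly (Q k)) (poly q) sequentially"
  shows "(\<lambda>k. apply_poly (Q k) h) \<longlonglongrightarrow> apply_poly q h"
proof (rule tendstoI)
  fix e :: real assume "0 < e"
  then have "\<forall>\<^sub>F k in sequentially. \<forall>t\<in>S. dist (poly (Q k) t) (poly q t) < e / 2"
    using uniform_limitD[OF Q, of "e / 2"] by simp
  then show "\<forall>\<^sub>F k in sequentially. dist (apply_poly (Q k) h) (apply_poly q h) < e"
  proof eventually_elim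
    case (elim k)
    have "norm (apply_poly (Q k - q) h) \<le> e / 2"
      by (rule norm_apply_poly_le[OF assms(1,2)])
        (use elim \<open>0 < e\<close> in \<open>auto simp: dist_real_def less_imp_le\<close>)
    then show ?case using \<open>0 < e\<close> by (simp add: dist_norm apply_poly_diff)
  qed
qed

text \<open>Contractivity makes the values a Cauchy sequence; the limit serves as the value of
  \<open>f\<close> at \<open>h\<close> in the continuous functional calculus.\<close>

lemma apply_poly_limit_exists:
  fixes h :: "'a::{cstar_algebra, real_normed_algebra_1}"
  assumes "adj h = h" "unital_spectrum h \<subseteq> of_real ` S"
    and Q: "uniform_limit S (\<lambda>k. poly (Q k)) f sequentially"
  shows "\<exists>b. (\<lambda>k. apply_poly (Q k) h) \<longlonglongrightarrow> b"
proof -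
  have "Cauchy (\<lambda>k. apply_poly (Q k) h)"
  proof (rule metric_CauchyI)
    fix e :: real assume "0 < e"
    then obtain N where N: "\<And>k t. k \<ge> N \<Longrightarrow> t \<in> S \<Longrightarrow> dist (poly (Q k) t) (f t) < e / 4"
      using uniform_limitD[OF Q, of "e / 4"] by (auto simp: eventually_sequentially)
    have "dist (apply_poly (Q j) h) (apply_poly (Q k) h) < e" if "j \<ge> N" "k \<ge> N" for j k
    proof -
      have "norm (apply_poly (Q j - Q k) h) \<le> e / 2"
      proof (rule norm_apply_poly_le[OF assms(1,2)])
        fix t assume "t \<in> S"
        then show "\<bar>poly (Q j - Q k) t\<bar> \<le> e / 2"
          using N[of j t] N[of k t] that by (auto simp: dist_real_def abs_if split: if_splits)
      qed (use \<open>0 < e\<close> in auto)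
      then show ?thesis using \<open>0 < e\<close> by (simp add: dist_norm apply_poly_diff)
    qed
    then show "\<exists>N. \<forall>j\<ge>N. \<forall>k\<ge>N. dist (apply_poly (Q j) h) (apply_poly (Q k) h) < e" by blast
  qed
  then show ?thesis by (simp add: Cauchy_convergent_iff convergent_def)
qed

lemma uniform_limit_power:
  fixes f :: "'b \<Rightarrow> real"
  assumes "uniform_limit S g f sequentially" "bounded (f ` S)"
  shows "uniform_limit S (\<lambda>k t. g k t ^ n) (\<lambda>t. f t ^ n) sequentially"
proof (induction n)
  case (Suc n)
  obtain B where B: "\<And>t. t \<in> S \<Longrightarrow> \<bar>f t\<bar> \<le> B" using assms(2) by (auto simp: bounded_iff)
  have "bounded ((\<lambda>t. f t ^ n) ` S)"
    unfolding bounded_iff by (rule exI[of _ "B ^ n"]) (auto simp: power_abs intro!: power_mono B)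
  then show ?case using uniform_lim_mult[OF assms(1) Suc assms(2)] by simp
qed (simp add: uniform_limit_const)

lemma ex_root_approx:
  assumes "n \<ge> 1"
  shows "\<exists>Q. uniform_limit {0..u} (\<lambda>k. poly (Q k)) (root n) sequentially \<and>
    (\<forall>k. \<forall>t\<in>{0..u}. 0 \<le> poly (Q k) t)"
proof -
  have "continuous_on {0..u} (root n)" by (intro continuous_intros)
  from poly_approx_from_above[OF this] obtain Q where
    "uniform_limit {0..u} (\<lambda>k. poly (Q k)) (root n) sequentially"
    "\<forall>k. \<forall>t\<in>{0..u}. root n t \<le> poly (Q k) t" by blast
  then show ?thesis
    by (intro exI[of _ Q] conjI allI ballI) (auto intro: order_trans[OF real_root_ge_zero[of _ n]])
qed

text \<open>Polynomials converging to the real root are applied to \<open>a\<close>; their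
  \<open>n\<close>-th powers converge uniformly to the identity function, hence at \<open>a\<close>
  to \<open>a\<close> itself.\<close>

lemma pos_root_exists:
  assumes a: "pos a" and n: "n \<ge> 1"
  shows "\<exists>b. pos b \<and> b ^ n = a"
proof -
  obtain Q where Q: "uniform_limit {0..norm a} (\<lambda>k. poly (Q k)) (root n) sequentially"
    "\<And>k t. t \<in> {0..norm a} \<Longrightarrow> 0 \<le> poly (Q k) t" using ex_root_approx[OF n] by metis
  note sp = pos_adj[OF a] pos_unital_spectrum[OF a]
  obtain b where b: "(\<lambda>k. apply_poly (Q k) a) \<longlonglongrightarrow> b" using apply_poly_limit_exists[OF sp Q(1)] by auto
  have "pos b" using pos_apply_poly[OF sp Q(2)] b by (rule pos_limit)
  have "bounded (root n ` {0..norm a})"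
    by (intro compact_imp_bounded compact_continuous_image continuous_intros compact_Icc)
  from uniform_limit_power[OF Q(1) this, of n]
  have "uniform_limit {0..norm a} (\<lambda>k t. poly (Q k) t ^ n) (\<lambda>t. root n t ^ n) sequentially" .
  then have "uniform_limit {0..norm a} (\<lambda>k. poly (Q k ^ n)) (poly [:0, 1:]) sequentially"
    by (rule uniform_limit_cong'[THEN iffD1, rotated 2]) (use n in auto)
  from apply_poly_limit_poly[OF sp this] have "(\<lambda>k. apply_poly (Q k) a ^ n) \<longlonglongrightarrow> a"
    by (simp add: apply_poly_power)
  moreover have "(\<lambda>k. apply_poly (Q k) a ^ n) \<longlonglongrightarrow> b ^ n" by (intro tendsto_power b)
  ultimately have "b ^ n = a" using LIMSEQ_unique by blast
  with \<open>pos b\<close> show ?thesis by blast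
qed

text \<open>One sequence of polynomials near the real root recovers both \<open>b\<close> and
  \<open>c\<close> from their common power; the interval up to \<open>u\<close> contains the
  \<open>n\<close>-th powers of both spectra.\<close>

lemma pos_root_unique:
  assumes b: "pos b" and c: "pos c" and n: "n \<ge> 1" and eq: "b ^ n = c ^ n"
  shows "b = c"
proof -
  define u where "u = max (norm b ^ n) (norm c ^ n)"
  obtain Q where Q: "uniform_limit {0..u} (\<lambda>k. poly (Q k)) (root n) sequentially"
    using ex_root_approx[OF n] by metis
  have "(\<lambda>k. apply_poly (Q k) (d ^ n)) \<longlonglongrightarrow> d" if d: "pos d" "norm d ^ n \<le> u" for d :: 'a
  proof -
    have "uniform_limit {0..norm d} (\<lambda>k t. poly (Q k) (t ^ n)) (\<lambda>t. root n (t ^ n)) sequentially"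
    proof (rule uniform_limitI)
      fix e :: real assume "0 < e"
      have "t ^ n \<in> {0..u}" if "t \<in> {0..norm d}" for t
        using that d(2) power_mono[of t "norm d" n] by auto
      then show "\<forall>\<^sub>F k in sequentially. \<forall>t\<in>{0..norm d}. dist (poly (Q k) (t ^ n)) (root n (t ^ n)) < e"
        using uniform_limitD[OF Q \<open>0 < e\<close>] by (auto elim!: eventually_mono)
    qed
    then have "uniform_limit {0..norm d} (\<lambda>k. poly (Q k \<circ>\<^sub>p monom 1 n)) (poly [:0, 1:]) sequentially"
      by (rule uniform_limit_cong'[THEN iffD1, rotated 2])
        (use n in \<open>auto simp: poly_pcompose poly_monom real_root_power_cancel\<close>)
    from apply_poly_limit_poly[OF pos_adj[OF d(1)] pos_unital_spectrum[OF d(1)] this]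
    show ?thesis by (simp add: apply_poly_pcompose apply_poly_monom)
  qed
  from this[of b] this[of c] show ?thesis
    using b c eq LIMSEQ_unique by (auto simp: u_def)
qed

section \<open>Positive and negative parts, and positivity of \<open>adj x * x\<close>\<close>

lemma self_adjoint_decomposition:
  fixes h :: "'a::{cstar_algebra, real_normed_algebra_1}"
  assumes h: "adj h = h"
  shows "\<exists>p m. pos p \<and> pos m \<and> h = p - m \<and> m * p = 0"
proof -
  define S where "S = {- norm h..norm h}"
  note sp = h unital_spectrum_self_adjoint[OF h, folded S_def]
  \<comment> \<open>Approximating the positive part from above makes both \<open>Q k\<close> and
    \<open>Q k\<close> minus the identity nonnegative on \<open>S\<close>, so \<open>p\<close> and
    \<open>p - h\<close> become positive.\<close>
  have "continuous_on S (\<lambda>t. max t 0)" by (intro continuous_intros)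
  from poly_approx_from_above[OF this[unfolded S_def], folded S_def] obtain Q where
    Q: "uniform_limit S (\<lambda>k. poly (Q k)) (\<lambda>t. max t 0) sequentially"
    "\<And>k t. t \<in> S \<Longrightarrow> max t 0 \<le> poly (Q k) t" by blast
  obtain p where p: "(\<lambda>k. apply_poly (Q k) h) \<longlonglongrightarrow> p" using apply_poly_limit_exists[OF sp Q(1)] by auto
  have "pos p"
  proof (rule pos_limit[OF _ p])
    show "pos (apply_poly (Q k) h)" for k using Q(2)[of _ k] by (intro pos_apply_poly[OF sp]) auto
  qed
  define R where "R k = Q k - [:0, 1:]" for k
  have "(\<lambda>k. apply_poly (Q k) h - h) \<longlonglongrightarrow> p - h" by (intro tendsto_intros p)
  then have m: "(\<lambda>k. apply_poly (R k) h) \<longlonglongrightarrow> p - h" by (simp add: R_def apply_poly_diff)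
  have "pos (p - h)"
  proof (rule pos_limit[OF _ m])
    show "pos (apply_poly (R k) h)" for k
      using Q(2)[of _ k] by (intro pos_apply_poly[OF sp]) (auto simp: R_def)
  qed
  have "bounded S" by (simp add: S_def)
  then have bd: "bounded ((\<lambda>t. max t 0) ` S)" "bounded ((\<lambda>t. max t 0 - t) ` S)"
    unfolding S_def by (auto intro!: compact_imp_bounded compact_continuous_image continuous_intros)
  \<comment> \<open>The function \<open>(max t 0 - t) * max t 0\<close> vanishes identically, so the
    product of the two limits is 0.\<close>
  have "uniform_limit S (\<lambda>k t. (poly (Q k) t - t) * poly (Q k) t) (\<lambda>t. (max t 0 - t) * max t 0) sequentially"
    by (intro uniform_lim_mult uniform_limit_minus Q bd uniform_limit_const)
  then have "uniform_limit S (\<lambda>k. poly (R k * Q k)) (poly 0) sequentially"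
    by (rule uniform_limit_cong'[THEN iffD1, rotated 2]) (auto simp: R_def)
  from apply_poly_limit_poly[OF sp this]
  have "(\<lambda>k. apply_poly (R k) h * apply_poly (Q k) h) \<longlonglongrightarrow> 0" by (simp add: apply_poly_mult)
  then have "(p - h) * p = 0" using tendsto_mult[OF m p] LIMSEQ_unique by blast
  then show ?thesis using \<open>pos p\<close> \<open>pos (p - h)\<close> by (intro exI[of _ p] exI[of _ "p - h"]) simp
qed

lemma pos_adj_mult_self: "pos (adj x * x)"
proof -
  have sa: "adj (adj x * x) = adj x * x" by (simp add: adj_mult adj_adj)
  from self_adjoint_decomposition[OF this] obtain p m where
    pm: "pos p" "pos m" "adj x * x = p - m" "m * p = 0" by blast
  \<comment> \<open>Compressing by the negative part kills \<open>p\<close>, so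
    \<open>adj y * y = - m^3\<close>; the goal is \<open>m = 0\<close>.\<close>
  define y where "y = x * m"
  have yy: "adj y * y = - (m ^ 3)"
  proof -
    have "adj y * y = m * (adj x * x) * m" by (simp add: y_def adj_mult pos_adj[OF pm(2)] mult.assoc)
    also have "\<dots> = (m * p) * m - m ^ 3"
      unfolding pm(3) by (simp add: algebra_simps power3_eq_cube)
    finally show ?thesis by (simp add: pm(4))
  qed
  have "pos (m ^ 3)" using pm(2) by (rule pos_power)
  \<comment> \<open>The nonzero spectrum of \<open>- (y * adj y)\<close> agrees with that of
    \<open>- (adj y * y) = m^3\<close>.\<close>
  have n: "pos (- (y * adj y))"
    unfolding pos_def
  proof (intro conjI subsetI)
    fix z assume z: "z \<in> unital_spectrum (- (y * adj y))"
    show "z \<in> of_real ` {0..}"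
    proof (cases "z = 0")
      case False
      have "z \<in> unital_spectrum ((- y) * adj y)" using z by simp
      from unital_spectrum_mult_commute[OF this False] have "z \<in> unital_spectrum (m ^ 3)" by (simp add: yy)
      then show ?thesis using \<open>pos (m ^ 3)\<close> by (auto simp: pos_def)
    qed (auto intro!: image_eqI[of _ _ 0])
  qed (simp add: adj_mult adj_adj)
  \<comment> \<open>Up to real factors these are the real and imaginary parts of \<open>y\<close>;
    \<open>u * u + v * v\<close> is twice \<open>adj y * y + y * adj y\<close>, which is therefore
    positive. Adding \<open>- (y * adj y)\<close> leaves \<open>- m^3\<close>.\<close>
  define u v where "u = y + adj y" and "v = \<i> *\<^sub>C (y - adj y)"
  have "adj u = u" "adj v = v"
    by (simp_all add: u_def v_def adj_add adj_diff adj_scaleC adj_adj scaleC_diff_right)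
  then have "pos ((1 / 2) *\<^sub>R (u * u + v * v))" by (intro pos_scaleR pos_add pos_square) auto
  moreover have "u * u + v * v = (adj y * y + y * adj y) + (adj y * y + y * adj y)"
    by (simp add: u_def v_def mult_scaleC_left mult_scaleC_right scaleC_scaleC scaleC_diff_right
        algebra_simps)
  ultimately have "pos (adj y * y + y * adj y)" by (simp only: scaleR_half_double)
  from pos_add[OF this n] have "pos (- (m ^ 3))" by (simp add: yy)
  then have "m ^ 3 = 0" using \<open>pos (m ^ 3)\<close> pos_antisym by blast
  \<comment> \<open>A fourth power, so that the norm identity for exponents \<open>2^m\<close>
    applies.\<close>
  then have "m ^ 2 ^ 2 = 0" by (simp add: power_numeral_reduce)
  then have "norm m = 0" using norm_power_two_power[OF pos_adj[OF pm(2)], of 2] by simp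
  then show ?thesis using pm by simp
qed

text \<open>After conjugation by \<open>r\<close>, one summand is dominated by the whole sum, and
  the norm is monotone on positive elements.\<close>

lemma norm_mult_le_of_sum_squares:
  fixes z :: "'i \<Rightarrow> 'a::{cstar_algebra, real_normed_algebra_1}"
  assumes "finite S" "i \<in> S"
  shows "(norm (z i * r))\<^sup>2 \<le> norm (adj r * (\<Sum>j\<in>S. adj (z j) * z j) * r)"
proof -
  have e: "adj r * (\<Sum>j\<in>T. adj (z j) * z j) * r = (\<Sum>j\<in>T. adj (z j * r) * (z j * r))" for T
    by (simp add: sum_distrib_left sum_distrib_right adj_mult mult.assoc)
  have "norm (adj (z i * r) * (z i * r)) \<le> norm (\<Sum>j\<in>S. adj (z j * r) * (z j * r))"
  proof (rule pos_norm_mono)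
    have "(\<Sum>j\<in>S. adj (z j * r) * (z j * r)) - adj (z i * r) * (z i * r) =
        (\<Sum>j\<in>S - {i}. adj (z j * r) * (z j * r))"
      using sum.remove[OF assms, of "\<lambda>j. adj (z j * r) * (z j * r)"] by simp
    then show "pos ((\<Sum>j\<in>S. adj (z j * r) * (z j * r)) - adj (z i * r) * (z i * r))"
      by (simp add: pos_sum pos_adj_mult_self)
  qed (rule pos_adj_mult_self)
  then show ?thesis by (simp add: e cstar_identity)
qed

section \<open>Decay estimates and factorizations\<close>

definition embed :: "'a::cstar_algebra \<Rightarrow> 'a unitization" where
  "embed a = Unitization a 0"

lemma embed_eq_iff [simp]: "embed a = embed b \<longleftrightarrow> a = b"
  by (simp add: embed_def)

lemma embed_add: "embed (a + b) = embed a + embed b"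
  by (simp add: embed_def unitization_defs)

lemma embed_diff: "embed (a - b) = embed a - embed b"
  by (simp add: embed_def unitization_defs)

lemma embed_mult: "embed (a * b) = embed a * embed b"
  by (simp add: embed_def unitization_defs)

lemma embed_scaleR: "embed (r *\<^sub>R a) = r *\<^sub>R embed a"
  by (simp add: embed_def unitization_defs)

lemma embed_adj: "embed (adj a) = adj (embed a)"
  by (simp add: embed_def unitization_defs)

lemma embed_sum: "embed (\<Sum>i\<in>S. f i) = (\<Sum>i\<in>S. embed (f i))"
  by (induction S rule: infinite_finite_induct) (simp_all add: embed_add embed_def[of 0] zero_unitization_def)

lemma range_embed_iff: "u \<in> range embed \<longleftrightarrow> scalar_part u = 0"
  by (cases u) (auto simp: embed_def)

lemma scalar_part_simps [simp]:
  "scalar_part 0 = 0" "scalar_part 1 = 1" "scalar_part (u + v) = scalar_part u + scalar_part v"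
  "scalar_part (u * v) = scalar_part u * scalar_part v" "scalar_part (embed a) = 0"
  by (simp_all add: unitization_defs one_unitization_def embed_def)

lemma scalar_part_power [simp]: "scalar_part (u ^ n) = scalar_part u ^ n"
  by (induction n) simp_all

lemma scalar_part_sum: "scalar_part (\<Sum>i\<in>S. f i) = (\<Sum>i\<in>S. scalar_part (f i))"
  by (induction S rule: infinite_finite_induct) simp_all

text \<open>The scalar part is continuous, so the copy of the algebra is closed; limits of series
  formed with the adjoined unit fall back into it.\<close>

lemma limit_in_range_embed:
  assumes X: "\<And>n. X n \<in> range embed" and lim: "X \<longlonglongrightarrow> u"
  shows "u \<in> range embed"
proof -
  have "(\<lambda>n. norm (X n - u)) \<longlonglongrightarrow> 0" using lim by (simp add: tendsto_norm_zero LIM_zero)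
  moreover have "cmod (scalar_part u) \<le> norm (X n - u)" for n
    using cmod_scalar_part_le[of "X n - u"] X[of n]
    by (simp add: range_embed_iff minus_unitization_def)
  ultimately have "cmod (scalar_part u) \<le> 0" by (intro Lim_bounded2[of "\<lambda>n. norm (X n - u)" _ 0]) auto
  then show ?thesis by (simp add: range_embed_iff)
qed

section \<open>Decay of \<open>b^k (1 - b^l)^n\<close>\<close>

lemma power_mult_exp_le:
  fixes y :: real
  assumes "0 < y" "0 \<le> r" "r \<le> 4"
  shows "y powr r \<le> 65 * exp y"
proof -
  have e: "1 \<le> exp y" using assms by simp
  have "y powr r \<le> 1 + y ^ 4"
  proof (cases "y \<le> 1")
    case True
    then have "y powr r \<le> 1" using assms by (simp add: powr_le1)
    then show ?thesis using zero_le_power[of y 4] assms by linarith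
  next
    case False
    then have "y powr r \<le> y powr 4" using assms by (intro powr_mono) auto
    also have "\<dots> = y ^ 4" using assms by (simp add: powr_numeral)
    finally show ?thesis by simp
  qed
  \<comment> \<open>The constant 64 comes from squaring the quadratic Taylor bound at
    \<open>y / 2\<close>; together with the 1 above it makes 65.\<close>
  also have "y ^ 4 \<le> 64 * exp y"
  proof -
    have "1 + y / 2 + (y / 2)\<^sup>2 / 2 \<le> exp (y / 2)"
      using assms by (intro exp_lower_Taylor_quadratic) auto
    then have "(y / 2)\<^sup>2 / 2 \<le> exp (y / 2)" using assms by simp
    then have "((y / 2)\<^sup>2 / 2)\<^sup>2 \<le> (exp (y / 2))\<^sup>2" by (intro power_mono) auto
    also have "(exp (y / 2))\<^sup>2 = exp y" by (simp flip: exp_double)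
    finally show ?thesis by (simp add: power2_eq_square power4_eq_xxxx field_simps)
  qed
  finally show ?thesis using e by linarith
qed

text \<open>With \<open>s = t^l\<close> and \<open>r = k / l\<close> the power \<open>t^k\<close> is
  \<open>s powr r\<close>, and \<open>(1 - s)^n\<close> is at most \<open>exp (- n s)\<close>; the
  bound for \<open>y powr r\<close> at \<open>y = n s\<close> finishes.\<close>

lemma power_mult_one_minus_le:
  fixes t :: real
  assumes t: "0 \<le> t" "t \<le> 1" and l: "1 \<le> l" and k: "k \<le> 4 * l" and n: "1 \<le> n"
  shows "t ^ k * (1 - t ^ l) ^ n \<le> 65 * real n powr (- (real k / real l))"
proof (cases "t = 0")
  case True
  then show ?thesis using l n by (cases "k = 0") (auto simp: power_0_left)
next
  case False
  define s r where "s = t ^ l" and "r = real k / real l"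
  have s: "0 < s" "s \<le> 1" using t False by (auto simp: s_def power_le_one)
  have r: "0 \<le> r" "r \<le> 4" using k l by (auto simp: r_def field_simps)
  have "t ^ k = t powr (real l * r)" using t False l by (simp add: r_def powr_realpow)
  also have "\<dots> = s powr r" using t False by (simp add: s_def powr_powr[symmetric] powr_realpow)
  finally have tk: "t ^ k = s powr r" .
  have "(1 - s) ^ n \<le> exp (- s) ^ n" using s exp_ge_add_one_self[of "- s"] by (intro power_mono) auto
  also have "\<dots> = exp (- (real n * s))" by (simp flip: exp_of_nat_mult)
  finally have "t ^ k * (1 - t ^ l) ^ n \<le> s powr r * exp (- (real n * s))"
    unfolding tk s_def[symmetric] by (intro mult_left_mono) auto
  also have "s powr r = (real n * s) powr r * real n powr (- r)"
    using s n by (simp add: powr_mult powr_minus field_simps)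
  also have "(real n * s) powr r * real n powr (- r) * exp (- (real n * s)) \<le>
      (65 * exp (real n * s)) * real n powr (- r) * exp (- (real n * s))"
    using s n r by (intro mult_right_mono power_mult_exp_le) auto
  also have "\<dots> = 65 * real n powr (- r)" by (simp add: exp_minus field_simps)
  finally show ?thesis by (simp add: r_def)
qed

lemma norm_power_mult_one_minus_le:
  fixes b :: "'a::{cstar_algebra, real_normed_algebra_1}"
  assumes b: "pos b" "norm b \<le> 1" and lkn: "1 \<le> l" "k \<le> 4 * l" "1 \<le> n"
  shows "norm (b ^ k * (1 - b ^ l) ^ n) \<le> 65 * real n powr (- (real k / real l))"
proof -
  have "norm (apply_poly (monom 1 k * (1 - monom 1 l) ^ n) b) \<le> 65 * real n powr (- (real k / real l))"
  proof (rule norm_apply_poly_le[OF pos_adj[OF b(1)] pos_unital_spectrum[OF b(1)]])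
    fix t assume "t \<in> {0..norm b}"
    then have t: "0 \<le> t" "t \<le> 1" using b(2) by auto
    then have "0 \<le> t ^ k * (1 - t ^ l) ^ n" by (simp add: power_le_one)
    then show "\<bar>poly (monom 1 k * (1 - monom 1 l) ^ n) t\<bar> \<le> 65 * real n powr (- (real k / real l))"
      using power_mult_one_minus_le[OF t lkn] by (simp add: poly_monom)
  qed simp
  then show ?thesis by (simp add: apply_poly_mult apply_poly_power apply_poly_diff apply_poly_monom)
qed

lemma norm_one_minus_power_le:
  fixes b :: "'a::{cstar_algebra, real_normed_algebra_1}"
  assumes b: "pos b" "norm b \<le> 1"
  shows "norm ((1 - b ^ l) ^ n) \<le> 1"
proof -
  have "norm (apply_poly ((1 - monom 1 l) ^ n) b) \<le> 1"
  proof (rule norm_apply_poly_le[OF pos_adj[OF b(1)] pos_unital_spectrum[OF b(1)]])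
    fix t assume "t \<in> {0..norm b}"
    then have "0 \<le> 1 - t ^ l" "1 - t ^ l \<le> 1" using b(2) by (auto simp: power_le_one)
    then show "\<bar>poly ((1 - monom 1 l) ^ n) t\<bar> \<le> 1" by (simp add: poly_monom power_le_one)
  qed simp
  then show ?thesis by (simp add: apply_poly_power apply_poly_diff apply_poly_monom)
qed

lemma power_commute_one_minus:
  fixes b :: "'a::{cstar_algebra, real_normed_algebra_1}"
  shows "(1 - b ^ l) ^ n * b ^ k = b ^ k * (1 - b ^ l) ^ n"
  using apply_poly_mult[of "(1 - monom 1 l) ^ n" "monom 1 k" b]
    apply_poly_mult[of "monom 1 k" "(1 - monom 1 l) ^ n" b]
  by (simp add: apply_poly_power apply_poly_diff apply_poly_monom mult.commute)

section \<open>Division by powers of a positive element\<close>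

lemma summable_of_powr_bound:
  fixes f :: "nat \<Rightarrow> 'a::banach"
  assumes f: "\<And>n. 1 \<le> n \<Longrightarrow> norm (f n) \<le> C * real n powr (- r)" and r: "1 < r"
  shows "summable f"
proof -
  have "summable (\<lambda>n. C * real n powr (- r))"
    using r by (intro summable_mult) (simp add: summable_real_powr_iff)
  then show ?thesis by (rule summable_comparison_test'[of _ 1]) (use f in auto)
qed

lemma embed_limit_obtain:
  assumes "\<And>n. X n \<in> range embed" "X \<longlonglongrightarrow> u"
  obtains v where "u = embed v" "X \<longlonglongrightarrow> embed v"
  using limit_in_range_embed[OF assms] assms(2) by auto

text \<open>Formally \<open>v\<close> is \<open>x\<close> divided by \<open>c\<close>, with the
  inverse of \<open>c\<close> expanded as the geometric series in \<open>1 - c\<close>. The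
  convergence is recorded besides the factorization because adjoints of the partial sums are used
  later.\<close>

lemma right_factor:
  assumes sm: "summable (\<lambda>n. embed x * (1 - c) ^ n)"
  shows "\<exists>v. (\<lambda>N. embed x * (\<Sum>n<N. (1 - c) ^ n)) \<longlonglongrightarrow> embed v \<and> embed x = embed v * c"
proof -
  have eq: "(\<Sum>n<N. embed x * (1 - c) ^ n) = embed x * (\<Sum>n<N. (1 - c) ^ n)" for N
    by (simp add: sum_distrib_left)
  have lim: "(\<lambda>N. embed x * (\<Sum>n<N. (1 - c) ^ n)) \<longlonglongrightarrow> suminf (\<lambda>n. embed x * (1 - c) ^ n)"
    using summable_LIMSEQ[OF sm] by (simp add: eq)
  then obtain v where v: "(\<lambda>N. embed x * (\<Sum>n<N. (1 - c) ^ n)) \<longlonglongrightarrow> embed v"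
    by (rule embed_limit_obtain[rotated]) (auto simp: range_embed_iff)
  have "(\<lambda>N. embed x * (\<Sum>n<N. (1 - c) ^ n) * c) \<longlonglongrightarrow> embed v * c"
    by (intro tendsto_mult v tendsto_const)
  moreover have "embed x * (\<Sum>n<N. (1 - c) ^ n) * c = embed x - embed x * (1 - c) ^ N" for N
    using geometric_telescope(2)[of "1 - c" N] by (simp add: mult.assoc right_diff_distrib)
  moreover have "(\<lambda>N. embed x - embed x * (1 - c) ^ N) \<longlonglongrightarrow> embed x - 0"
    by (intro tendsto_intros summable_LIMSEQ_zero[OF sm])
  ultimately have "embed x = embed v * c" using LIMSEQ_unique by force
  with v show ?thesis by blast
qed

lemma right_factor_power_of_decay:
  assumes decay: "\<And>n. 1 \<le> n \<Longrightarrow> norm (embed x * (1 - c) ^ n) \<le> C * real n powr (- r)" and r: "1 < r"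
  shows "\<exists>v. (\<lambda>N. embed x * (\<Sum>n<N. (1 - c) ^ n)) \<longlonglongrightarrow> embed v \<and> embed x = embed v * c"
  using right_factor[OF summable_of_powr_bound[OF decay r]] .

text \<open>The hypothesis \<open>le\<close> expresses that \<open>adj x * x\<close> is dominated by
  \<open>b^(2p)\<close> up to a constant. It transfers to \<open>x\<close> the decay of
  \<open>b^p (1 - b^l)^n\<close>, of order \<open>n\<close> to the power \<open>- p / l\<close>,
  which is summable because \<open>p > l\<close>.\<close>

lemma right_factor_power_contraction:
  assumes b: "pos (embed b)" "norm (embed b) \<le> 1"
    and le: "\<And>s. norm (embed x * s) \<le> C * norm (embed b ^ p * s)"
    and lp: "1 \<le> l" "l < p" "p \<le> 4 * l" and C: "0 \<le> C"
  shows "\<exists>v. (\<lambda>N. embed x * (\<Sum>n<N. (1 - embed b ^ l) ^ n)) \<longlonglongrightarrow> embed v \<and>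
    embed x = embed v * embed b ^ l"
proof (rule right_factor_power_of_decay)
  fix n :: nat assume n: "1 \<le> n"
  have "norm (embed x * (1 - embed b ^ l) ^ n) \<le> C * norm (embed b ^ p * (1 - embed b ^ l) ^ n)"
    by (rule le)
  also have "\<dots> \<le> C * (65 * real n powr (- (real p / real l)))"
    by (intro mult_left_mono norm_power_mult_one_minus_le b lp n C)
  finally show "norm (embed x * (1 - embed b ^ l) ^ n) \<le> C * 65 * real n powr (- (real p / real l))"
    by simp
qed (use lp in \<open>simp add: field_simps\<close>)

lemma ex_contraction:
  assumes "pos (embed b)"
  obtains s b' where "0 < s" "pos (embed b')" "norm (embed b') \<le> 1" "embed b' = s *\<^sub>R embed b"
proof
  \<comment> \<open>The 1 in the denominator covers \<open>b = 0\<close>.\<close>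
  define s where "s = 1 / (1 + norm (embed b))"
  have n: "0 < 1 + norm (embed b)" using norm_ge_zero[of "embed b"] by linarith
  show s: "0 < s" using n by (simp add: s_def)
  show "embed (s *\<^sub>R b) = s *\<^sub>R embed b" by (rule embed_scaleR)
  then show "pos (embed (s *\<^sub>R b))" using assms s by (simp add: pos_scaleR)
  show "norm (embed (s *\<^sub>R b)) \<le> 1" using n by (simp add: embed_scaleR s_def)
qed

lemma right_factor_power:
  assumes b: "pos (embed b)"
    and le: "\<And>s. norm (embed x * s) \<le> C * norm (embed b ^ p * s)"
    and lp: "1 \<le> l" "l < p" "p \<le> 4 * l" and C: "0 \<le> C"
  shows "\<exists>v. embed x = embed v * embed b ^ l"
proof -
  obtain s b' where s: "0 < s" and b': "pos (embed b')" "norm (embed b') \<le> 1" "embed b' = s *\<^sub>R embed b"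
    using ex_contraction[OF b] .
  have "embed b ^ p = inverse (s ^ p) *\<^sub>R embed b' ^ p" using s by (simp add: b'(3) scaleR_power)
  then have "norm (embed x * u) \<le> (C * inverse (s ^ p)) * norm (embed b' ^ p * u)" for u
    using le[of u] s by (simp add: mult.assoc)
  from right_factor_power_contraction[OF b'(1,2) this lp] C s
  obtain v where "embed x = embed v * embed b' ^ l" by auto
  then have "embed x = embed (s ^ l *\<^sub>R v) * embed b ^ l" by (simp add: b'(3) scaleR_power embed_scaleR)
  then show ?thesis by blast
qed

text \<open>The series \<open>y = \<Sum>\<^sub>n (1 - c)\<^sup>n z (1 - c)\<^sup>n\<close> with \<open>z = b\<^sup>k x b\<^sup>m\<close> and \<open>c = b\<^sup>l\<close> solves
  \<open>y - (1 - c) y (1 - c) = z\<close>, that is, \<open>z = c y + y c - c y c\<close>. It converges because its terms are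
  of order \<open>n\<close> to the power \<open>- (k + m) / l\<close>.\<close>

lemma sandwich_decomposition_contraction:
  assumes b: "pos (embed b)" "norm (embed b) \<le> 1"
    and klm: "1 \<le> l" "l < k + m" "k \<le> 4 * l" "m \<le> 4 * l"
  shows "\<exists>y y'. embed b ^ k * embed x * embed b ^ m = embed b ^ l * embed y + embed y' * embed b ^ l"
proof -
  define c where "c = embed b ^ l"
  define z where "z = embed b ^ k * embed x * embed b ^ m"
  have z0: "scalar_part z = 0" by (simp add: z_def)
  define f where "f n = (1 - c) ^ n * z * (1 - c) ^ n" for n
  define K where "K = 65 * norm (embed x) * 65"
  have fle: "norm (f n) \<le> K * real n powr (- (real (k + m) / real l))"
    if n: "1 \<le> n" for n
  proof -
    have cm: "(1 - c) ^ n * embed b ^ k = embed b ^ k * (1 - c) ^ n"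
      unfolding c_def by (rule power_commute_one_minus)
    have "f n = (embed b ^ k * (1 - c) ^ n) * embed x * (embed b ^ m * (1 - c) ^ n)"
      unfolding f_def z_def cm[symmetric] by (simp add: mult.assoc)
    then have "norm (f n) \<le>
        norm (embed b ^ k * (1 - c) ^ n) * norm (embed x) * norm (embed b ^ m * (1 - c) ^ n)"
      by (simp only:) (rule order_trans[OF norm_mult_ineq mult_right_mono[OF norm_mult_ineq norm_ge_zero]])
    also have "\<dots> \<le> (65 * real n powr (- (real k / real l))) * norm (embed x) *
        (65 * real n powr (- (real m / real l)))"
      unfolding c_def
      by (intro mult_mono norm_power_mult_one_minus_le b klm n order_refl mult_nonneg_nonneg) auto
    also have "\<dots> = K * (real n powr (- (real k / real l)) * real n powr (- (real m / real l)))"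
      by (simp add: K_def)
    also have "\<dots> = K * real n powr (- (real (k + m) / real l))"
      by (simp add: powr_add[symmetric] add_divide_distrib)
    finally show ?thesis .
  qed
  have sm: "summable f"
    by (rule summable_of_powr_bound[OF fle]) (use klm in \<open>simp_all add: field_simps\<close>)
  have "(\<lambda>N. \<Sum>n<N. f n) \<longlonglongrightarrow> suminf f" by (rule summable_LIMSEQ[OF sm])
  then obtain y where y: "(\<lambda>N. \<Sum>n<N. f n) \<longlonglongrightarrow> embed y"
    by (rule embed_limit_obtain[rotated]) (auto simp: range_embed_iff scalar_part_sum f_def z0)
  have "(\<lambda>N. (\<Sum>n<N. f n) - (1 - c) * (\<Sum>n<N. f n) * (1 - c)) \<longlonglongrightarrow>
      embed y - (1 - c) * embed y * (1 - c)" by (intro tendsto_intros y)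
  moreover have "(\<Sum>n<N. f n) - (1 - c) * (\<Sum>n<N. f n) * (1 - c) = z - f N" for N
  proof (induction N)
    case (Suc N)
    have "(1 - c) * f N * (1 - c) = f (Suc N)"
      by (simp add: f_def mult.assoc power_commutes[of "1 - c" N] flip: power_Suc)
        (simp add: mult.assoc power_commutes)
    moreover have "(\<Sum>n<N. f n) + f N - (1 - c) * (\<Sum>n<N. f n) * (1 - c) - f (Suc N) =
        ((\<Sum>n<N. f n) - (1 - c) * (\<Sum>n<N. f n) * (1 - c)) + f N - f (Suc N)" by simp
    ultimately show ?case using Suc by (simp add: distrib_left distrib_right diff_diff_eq)
  qed (simp add: f_def)
  moreover have "(\<lambda>N. z - f N) \<longlonglongrightarrow> z - 0" by (intro tendsto_intros summable_LIMSEQ_zero[OF sm])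
  ultimately have "z = embed y - (1 - c) * embed y * (1 - c)" using LIMSEQ_unique by force
  also have "\<dots> = c * embed y + (embed y - c * embed y) * c" by (simp add: algebra_simps)
  finally have z: "z = c * embed y + (embed y - c * embed y) * c" .
  have "c * embed y \<in> range embed" by (simp add: range_embed_iff)
  then obtain w where "c * embed y = embed w" by auto
  then have "z = c * embed y + embed (y - w) * c" using z by (simp add: embed_diff)
  then show ?thesis unfolding z_def c_def by blast
qed

lemma sandwich_decomposition:
  assumes b: "pos (embed b)"
    and klm: "1 \<le> l" "l < k + m" "k \<le> 4 * l" "m \<le> 4 * l"
  shows "\<exists>y y'. embed b ^ k * embed x * embed b ^ m = embed b ^ l * embed y + embed y' * embed b ^ l"
proof -
  obtain s b' where s: "0 < s" and b': "pos (embed b')" "norm (embed b') \<le> 1" "embed b' = s *\<^sub>R embed b"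
    using ex_contraction[OF b] .
  obtain y y' where y: "embed b' ^ k * embed x * embed b' ^ m = embed b' ^ l * embed y + embed y' * embed b' ^ l"
    using sandwich_decomposition_contraction[OF b'(1,2) klm] by blast
  define t where "t = inverse (s ^ (k + m)) * s ^ l"
  have "embed b ^ j = inverse (s ^ j) *\<^sub>R embed b' ^ j" for j using s by (simp add: b'(3) scaleR_power)
  then have "embed b ^ k * embed x * embed b ^ m =
      inverse (s ^ (k + m)) *\<^sub>R (embed b' ^ k * embed x * embed b' ^ m)"
    by (simp add: power_add mult.commute)
  also have "\<dots> = embed b ^ l * embed (t *\<^sub>R y) + embed (t *\<^sub>R y') * embed b ^ l"
    unfolding y by (simp add: b'(3) scaleR_power embed_scaleR t_def scaleR_add_right)
  finally show ?thesis by blast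
qed

section \<open>Roots inside the algebra and domination by sums of squares\<close>

lemma pos_embed_root:
  assumes a: "pos (embed a)" and n: "1 \<le> n"
  obtains b where "pos (embed b)" "embed b ^ n = embed a"
proof -
  obtain u where u: "pos u" "u ^ n = embed a" using pos_root_exists[OF a n] by blast
  \<comment> \<open>\<open>u^n\<close> has scalar part 0, hence so has \<open>u\<close>, and the
    root taken in the unitization lies in the algebra.\<close>
  have "scalar_part u ^ n = 0" using arg_cong[OF u(2), of scalar_part] by simp
  then have "u \<in> range embed" using n by (simp add: range_embed_iff)
  then show thesis using u that by auto
qed

text \<open>The factor \<open>\<epsilon>\<close> records the rescaling that makes the root a
  contraction, as the decay estimates require.\<close>

lemma pos_embed_contractive_root:
  assumes a: "pos (embed a)" and n: "1 \<le> n"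
  obtains d \<epsilon> where "0 < \<epsilon>" "pos (embed d)" "norm (embed d) \<le> 1" "embed d ^ n = \<epsilon> *\<^sub>R embed a"
proof -
  obtain b where b: "pos (embed b)" "embed b ^ n = embed a" using pos_embed_root[OF a n] .
  obtain s d where "0 < s" "pos (embed d)" "norm (embed d) \<le> 1" "embed d = s *\<^sub>R embed b"
    using ex_contraction[OF b(1)] .
  then show thesis using that[of "s ^ n" d] b by (simp add: scaleR_power)
qed

lemma pos_embed_sum_squares: "pos (embed (\<Sum>j\<in>S. adj (z j) * z j))"
  by (simp add: embed_sum embed_mult embed_adj pos_sum pos_adj_mult_self)

text \<open>\<open>g\<close> is a rescaled root of order \<open>2p\<close> of the sum of squares, so
  every \<open>z i\<close> is dominated by \<open>g^p\<close> in the form that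
  \<open>right_factor_power\<close> takes as input.\<close>

lemma norm_embed_mult_le_of_sum_squares:
  assumes S: "finite S" "i \<in> S" and \<epsilon>: "0 < \<epsilon>" and g: "pos (embed g)"
    and eq: "embed g ^ (2 * p) = \<epsilon> *\<^sub>R embed (\<Sum>j\<in>S. adj (z j) * z j)"
  shows "norm (embed (z i) * s) \<le> sqrt (inverse \<epsilon>) * norm (embed g ^ p * s)"
proof -
  have "(norm (embed (z i) * s))\<^sup>2 \<le> norm (adj s * (\<Sum>j\<in>S. adj (embed (z j)) * embed (z j)) * s)"
    by (rule norm_mult_le_of_sum_squares[OF S])
  also have "(\<Sum>j\<in>S. adj (embed (z j)) * embed (z j)) = inverse \<epsilon> *\<^sub>R embed g ^ (2 * p)"
    using \<epsilon> by (simp add: eq embed_sum embed_mult embed_adj)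
  also have "adj s * (inverse \<epsilon> *\<^sub>R embed g ^ (2 * p)) * s =
      inverse \<epsilon> *\<^sub>R (adj (embed g ^ p * s) * (embed g ^ p * s))"
    by (simp add: adj_mult adj_power pos_adj[OF g] mult_2 power_add mult.assoc)
  also have "norm \<dots> = (sqrt (inverse \<epsilon>) * norm (embed g ^ p * s))\<^sup>2"
    using \<epsilon> by (simp add: cstar_identity power_mult_distrib)
  finally show ?thesis by (rule power2_le_imp_le) (use \<epsilon> in simp)
qed

section \<open>Translation of the given notions of spectrum, positivity and root\<close>

lemma spectrum_eq_unital_spectrum: "spectrum a = unital_spectrum (embed a)"
proof -
  have e: "embed a - z *\<^sub>C 1 = Unitization a (- z)" for z
    by (simp add: embed_def unitization_defs one_unitization_def)
  have m: "unitization_mult (x, c) (y, d) = (0, 1) \<longleftrightarrow> Unitization x c * Unitization y d = 1"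
    for x y :: 'a and c d
    by (simp add: unitization_mult_def unitization_defs one_unitization_def)
  have "(\<exists>u. unitization_mult (a, - z) u = (0, 1) \<and> unitization_mult u (a, - z) = (0, 1)) \<longleftrightarrow>
      has_inverse (embed a - z *\<^sub>C 1)" for z
    unfolding has_inverse_def e split_paired_Ex m by (metis unitization.exhaust)
  then show ?thesis by (simp add: spectrum_def unital_spectrum_def)
qed

lemma positive_elements_iff: "a \<in> positive_elements \<longleftrightarrow> pos (embed a)"
  by (simp add: positive_elements_def pos_def spectrum_eq_unital_spectrum flip: embed_adj)

lemma embed_nonempty_prod_replicate: "1 \<le> n \<Longrightarrow> embed (nonempty_prod (replicate n b)) = embed b ^ n"
proof (induction n rule: dec_induct)
  case (step n)
  then show ?case by (cases n) (simp_all add: embed_mult)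
qed simp

lemma positive_root_eqI:
  assumes "pos (embed b)" "1 \<le> n" "embed b ^ n = embed a"
  shows "positive_root n a = b"
  unfolding positive_root_def
proof (rule the_equality)
  show "b \<in> positive_elements \<and> nonempty_prod (replicate n b) = a"
    using assms embed_nonempty_prod_replicate[of n b] by (simp add: positive_elements_iff)
next
  fix c assume c: "c \<in> positive_elements \<and> nonempty_prod (replicate n c) = a"
  then have "embed c ^ n = embed b ^ n"
    using assms embed_nonempty_prod_replicate[of n c] by simp
  then show "c = b" using pos_root_unique assms c positive_elements_iff embed_eq_iff by metis
qed

section \<open>Powers of ideals\<close>

lemma two_sided_idealD:
  assumes "two_sided_ideal I"
  shows "0 \<in> I" "x \<in> I \<Longrightarrow> y \<in> I \<Longrightarrow> x - y \<in> I" "x \<in> I \<Longrightarrow> a * x \<in> I" "x \<in> I \<Longrightarrow> x * a \<in> I"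
    "x \<in> I \<Longrightarrow> - x \<in> I" "x \<in> I \<Longrightarrow> y \<in> I \<Longrightarrow> x + y \<in> I"
proof -
  show *: "0 \<in> I" "x \<in> I \<Longrightarrow> y \<in> I \<Longrightarrow> x - y \<in> I" "x \<in> I \<Longrightarrow> a * x \<in> I" "x \<in> I \<Longrightarrow> x * a \<in> I"
    for x y a using assms by (auto simp: two_sided_ideal_def)
  show m: "x \<in> I \<Longrightarrow> - x \<in> I" for x using *(2)[of 0 x] *(1) by simp
  show "x \<in> I \<Longrightarrow> y \<in> I \<Longrightarrow> x + y \<in> I" using *(2)[of x "- y"] m[of y] by simp
qed

lemma two_sided_ideal_sum:
  assumes "two_sided_ideal I" "\<And>i. i \<in> S \<Longrightarrow> f i \<in> I"
  shows "(\<Sum>i\<in>S. f i) \<in> I"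
  using assms(2)
  by (induction S rule: infinite_finite_induct) (auto intro: two_sided_idealD[OF assms(1)])

lemma group_closure_subset_ideal:
  assumes I: "two_sided_ideal I" and S: "S \<subseteq> I"
  shows "group_closure S \<subseteq> I"
proof
  fix x assume "x \<in> group_closure S"
  then show "x \<in> I" by induction (use S in \<open>auto intro: two_sided_idealD[OF I]\<close>)
qed

text \<open>\<open>f\<close> is additive since it respects differences; it is applied to
  multiplication on either side and to the identity map.\<close>

lemma group_closure_map:
  fixes f :: "'a::ab_group_add \<Rightarrow> 'b::ab_group_add"
  assumes x: "x \<in> group_closure S" and f: "\<And>a b. f (a - b) = f a - f b"
    and S: "\<And>a. a \<in> S \<Longrightarrow> f a \<in> group_closure T"
  shows "f x \<in> group_closure T"
  using x
proof induction
  case (base s)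
  have "f 0 = 0" using f[of 0 0] by simp
  with base S show ?case by auto
next
  case (diff s t)
  then show ?case by (simp add: f group_closure.diff)
qed

lemma two_sided_ideal_group_closure:
  assumes "\<And>a x. x \<in> S \<Longrightarrow> a * x \<in> S \<and> x * a \<in> S"
  shows "two_sided_ideal (group_closure S)"
  unfolding two_sided_ideal_def
proof (intro conjI ballI allI)
  fix a x assume x: "x \<in> group_closure S"
  show "a * x \<in> group_closure S"
    by (rule group_closure_map[OF x])
      (use assms in \<open>auto simp: right_diff_distrib intro: group_closure.base\<close>)
  show "x * a \<in> group_closure S"
    by (rule group_closure_map[OF x, where f = "\<lambda>x. x * a"])
      (use assms in \<open>auto simp: left_diff_distrib intro: group_closure.base\<close>)
qed (auto intro: group_closure.diff)

section \<open>Arithmetic of ideal powers\<close>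

lemma ideal_power_2: "ideal_power I 2 = group_closure {y * z | y z. y \<in> I \<and> z \<in> I}"
proof -
  have "{nonempty_prod xs | xs. length xs = 2 \<and> set xs \<subseteq> I} = {y * z | y z. y \<in> I \<and> z \<in> I}"
  proof (intro set_eqI iffI)
    fix x assume "x \<in> {nonempty_prod xs | xs. length xs = 2 \<and> set xs \<subseteq> I}"
    then obtain xs where xs: "x = nonempty_prod xs" "length xs = 2" "set xs \<subseteq> I" by auto
    then obtain y z where "xs = [y, z]" by (auto simp: length_Suc_conv numeral_2_eq_2)
    then show "x \<in> {y * z | y z. y \<in> I \<and> z \<in> I}" using xs by auto
  next
    fix x assume "x \<in> {y * z | y z. y \<in> I \<and> z \<in> I}"
    then obtain y z where "x = y * z" "y \<in> I" "z \<in> I" by auto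
    then show "x \<in> {nonempty_prod xs | xs. length xs = 2 \<and> set xs \<subseteq> I}"
      by (intro CollectI exI[of _ "[y, z]"]) auto
  qed
  then show ?thesis by (simp add: ideal_power_def)
qed

lemma nonempty_prod_Cons: "xs \<noteq> [] \<Longrightarrow> nonempty_prod (x # xs) = x * nonempty_prod xs"
  by (cases xs) auto

lemma nonempty_prod_append:
  "xs \<noteq> [] \<Longrightarrow> ys \<noteq> [] \<Longrightarrow> nonempty_prod (xs @ ys) = nonempty_prod xs * nonempty_prod ys"
proof (induction xs)
  case (Cons x xs)
  then show ?case by (cases "xs = []") (simp_all add: nonempty_prod_Cons mult.assoc)
qed simp

lemma nonempty_prod_in_ideal_power:
  "length xs = n \<Longrightarrow> set xs \<subseteq> I \<Longrightarrow> nonempty_prod xs \<in> ideal_power I n"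
  unfolding ideal_power_def by (intro group_closure.base insertI2) auto

lemma two_sided_ideal_ideal_power:
  assumes I: "two_sided_ideal I" and n: "1 \<le> n"
  shows "two_sided_ideal (ideal_power I n)"
  unfolding ideal_power_def
proof (rule two_sided_ideal_group_closure)
  fix a x assume "x \<in> {nonempty_prod xs | xs. length xs = n \<and> set xs \<subseteq> I}"
  then obtain xs where xs: "x = nonempty_prod xs" "length xs = n" "set xs \<subseteq> I" by auto
  then have "xs \<noteq> []" using n by auto
  \<comment> \<open>The factor \<open>a\<close> is absorbed by the first entry of the list, and for
    \<open>x * a\<close> by the last.\<close>
  have "a * x = nonempty_prod (a * hd xs # tl xs)"
    using xs \<open>xs \<noteq> []\<close> by (cases xs; cases "tl xs = []") (auto simp: nonempty_prod_Cons mult.assoc)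
  moreover have "set (a * hd xs # tl xs) \<subseteq> I"
    using xs \<open>xs \<noteq> []\<close> by (cases xs) (auto intro: two_sided_idealD[OF I])
  moreover have "length (a * hd xs # tl xs) = n" using xs \<open>xs \<noteq> []\<close> by (cases xs) auto
  ultimately have l: "a * x \<in> {nonempty_prod xs | xs. length xs = n \<and> set xs \<subseteq> I}" by blast
  define ys where "ys = butlast xs @ [last xs * a]"
  have "x = nonempty_prod (butlast xs @ [last xs])" using xs \<open>xs \<noteq> []\<close> by simp
  then have "x * a = nonempty_prod ys"
    by (cases "butlast xs = []") (simp_all add: ys_def nonempty_prod_append mult.assoc)
  moreover have "last xs * a \<in> I" using xs \<open>xs \<noteq> []\<close> last_in_set[of xs] two_sided_idealD(4)[OF I] by blast
  then have "set ys \<subseteq> I"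
    using xs \<open>xs \<noteq> []\<close> by (auto simp: ys_def dest: in_set_butlastD intro: two_sided_idealD[OF I])
  moreover have "length ys = n" using xs \<open>xs \<noteq> []\<close> by (cases xs) (auto simp: ys_def)
  ultimately show "a * x \<in> {nonempty_prod xs | xs. length xs = n \<and> set xs \<subseteq> I} \<and>
      x * a \<in> {nonempty_prod xs | xs. length xs = n \<and> set xs \<subseteq> I}" using l by blast
qed

lemma ideal_power_1:
  assumes "two_sided_ideal I"
  shows "ideal_power I 1 = I"
proof
  have "{nonempty_prod xs | xs. length xs = 1 \<and> set xs \<subseteq> I} \<subseteq> I"
    by (auto simp: length_Suc_conv)
  then show "ideal_power I 1 \<subseteq> I"
    unfolding ideal_power_def by (rule group_closure_subset_ideal[OF assms])
  show "I \<subseteq> ideal_power I 1"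
    using nonempty_prod_in_ideal_power[of "[_]" 1 I] by auto
qed

lemma ideal_power_Suc_subset:
  assumes I: "two_sided_ideal I" and n: "1 \<le> n"
  shows "ideal_power I (Suc n) \<subseteq> ideal_power I n"
  unfolding ideal_power_def[of I "Suc n"]
proof (rule group_closure_subset_ideal[OF two_sided_ideal_ideal_power[OF I n]], safe)
  fix xs assume xs: "length xs = Suc n" "set xs \<subseteq> I"
  then obtain x ys where x: "xs = x # ys" "length ys = n" by (cases xs) auto
  then have "ys \<noteq> []" using n by auto
  have "nonempty_prod ys \<in> ideal_power I n" using x xs by (intro nonempty_prod_in_ideal_power) auto
  then show "nonempty_prod xs \<in> ideal_power I n"
    using x \<open>ys \<noteq> []\<close> two_sided_idealD(3)[OF two_sided_ideal_ideal_power[OF I n]] by (simp add: nonempty_prod_Cons)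
qed

lemma ideal_power_antimono:
  assumes I: "two_sided_ideal I" and mn: "1 \<le> m" "m \<le> n"
  shows "ideal_power I n \<subseteq> ideal_power I m"
  using mn(2)
proof (induction n rule: dec_induct)
  case (step k)
  then show ?case using ideal_power_Suc_subset[OF I, of k] mn by auto
qed simp

lemma ideal_power_add_subset:
  assumes "1 \<le> m" "1 \<le> n"
  shows "ideal_power I (m + n) \<subseteq>
    group_closure {y * z | y z. y \<in> ideal_power I m \<and> z \<in> ideal_power I n}"
proof
  fix x assume "x \<in> ideal_power I (m + n)"
  then show "x \<in> group_closure {y * z | y z. y \<in> ideal_power I m \<and> z \<in> ideal_power I n}"
    unfolding ideal_power_def[of I "m + n"]
  proof (rule group_closure_map[where f = "\<lambda>x. x"], safe)
    fix xs assume xs: "length xs = m + n" "set xs \<subseteq> I"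
    have "nonempty_prod xs = nonempty_prod (take m xs) * nonempty_prod (drop m xs)"
      using xs assms by (subst nonempty_prod_append[symmetric]) auto
    moreover have "nonempty_prod (take m xs) \<in> ideal_power I m" "nonempty_prod (drop m xs) \<in> ideal_power I n"
      using xs set_take_subset[of m xs] set_drop_subset[of m xs]
      by (auto intro!: nonempty_prod_in_ideal_power)
    ultimately show "nonempty_prod xs \<in>
        group_closure {y * z | y z. y \<in> ideal_power I m \<and> z \<in> ideal_power I n}"
      by (intro group_closure.base insertI2) blast
  qed
qed

lemma mult_in_ideal_power_add:
  assumes mn: "1 \<le> m" "1 \<le> n" and y: "y \<in> ideal_power I m" and z: "z \<in> ideal_power I n"
  shows "y * z \<in> ideal_power I (m + n)"
proof -
  have *: "nonempty_prod xs * z \<in> ideal_power I (m + n)" if xs: "length xs = m" "set xs \<subseteq> I" for xs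
    using z unfolding ideal_power_def[of I n] ideal_power_def[of I "m + n"]
  proof (rule group_closure_map[where f = "\<lambda>z. nonempty_prod xs * z"], goal_cases)
    case (2 x)
    then obtain ys where "x = nonempty_prod ys" "length ys = n" "set ys \<subseteq> I" by blast
    then show ?case
      using xs mn nonempty_prod_append[of xs ys]
      by (intro group_closure.base insertI2 CollectI exI[of _ "xs @ ys"]) (auto simp: Suc_le_eq)
  qed (simp add: right_diff_distrib)
  show ?thesis
    using y unfolding ideal_power_def[of I m]
      ideal_power_def[of I "m + n"]
  proof (rule group_closure_map[where f = "\<lambda>y. y * z"], goal_cases)
    case (2 x)
    then show ?case using * unfolding ideal_power_def by blast
  qed (simp add: left_diff_distrib)
qed

text \<open>The power with exponent \<open>m + k\<close> is generated by the products from the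
  powers \<open>m\<close> and \<open>k\<close>, so it is determined by these two sets.\<close>

lemma ideal_power_add_cong:
  assumes "1 \<le> m" "1 \<le> n" "1 \<le> k" and eq: "ideal_power I m = ideal_power I n"
  shows "ideal_power I (m + k) = ideal_power I (n + k)"
proof -
  have "ideal_power I (a + k) = group_closure {y * z | y z. y \<in> ideal_power I a \<and> z \<in> ideal_power I k}"
    if "1 \<le> a" for a
  proof
    show "group_closure {y * z | y z. y \<in> ideal_power I a \<and> z \<in> ideal_power I k} \<subseteq> ideal_power I (a + k)"
    proof
      fix x assume "x \<in> group_closure {y * z | y z. y \<in> ideal_power I a \<and> z \<in> ideal_power I k}"
      then show "x \<in> ideal_power I (a + k)"
        unfolding ideal_power_def[of I "a + k"]
        by (rule group_closure_map[where f = "\<lambda>x. x"])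
          (use that assms(3) in \<open>auto simp: ideal_power_def[symmetric] intro: mult_in_ideal_power_add\<close>)
    qed
  qed (use ideal_power_add_subset that assms(3) in blast)
  then show ?thesis using assms by simp
qed

text \<open>With period \<open>d = n - m\<close>, all powers with exponent \<open>m + j * d\<close>
  agree with the power \<open>m\<close>. As \<open>m * d\<close> is at least \<open>m\<close>, the
  power \<open>2m\<close> is squeezed between two equal ones.\<close>

lemma ideal_power_stabilises:
  assumes I: "two_sided_ideal I" and m: "1 \<le> m" "m < n" and eq: "ideal_power I m = ideal_power I n"
  shows "ideal_power I m = ideal_power I (m + m)"
proof -
  define d where "d = n - m"
  have d: "1 \<le> d" "n = m + d" using m by (auto simp: d_def)
  have j: "ideal_power I (m + j * d) = ideal_power I m" for j
  proof (induction j)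
    case (Suc j)
    have "ideal_power I ((m + j * d) + d) = ideal_power I (m + d)"
      using Suc m d by (intro ideal_power_add_cong) auto
    then show ?case using eq d by (simp add: algebra_simps)
  qed simp
  have "m + m \<le> m + m * d" using d by simp
  from ideal_power_antimono[OF I _ this] m j[of m] have "ideal_power I m \<subseteq> ideal_power I (m + m)" by simp
  moreover have "ideal_power I (m + m) \<subseteq> ideal_power I m" using m by (intro ideal_power_antimono[OF I]) auto
  ultimately show ?thesis by blast
qed

lemma group_closure_products_sum:
  assumes I: "two_sided_ideal I" and x: "x \<in> group_closure {y * z | y z. y \<in> I \<and> z \<in> I}"
  shows "\<exists>n\<ge>1. \<exists>y z :: nat \<Rightarrow> 'a::ring. (\<forall>i\<in>{1..n}. y i \<in> I \<and> z i \<in> I) \<and> x = (\<Sum>i=1..n. y i * z i)"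
  using x
proof induction
  case (base s)
  \<comment> \<open>The closure always contains 0, which is written as \<open>0 * 0\<close>, so that
    every sum has at least one term.\<close>
  moreover have "\<exists>y z. y \<in> I \<and> z \<in> I \<and> 0 = y * z"
    using two_sided_idealD(1)[OF I] by (intro exI[of _ 0]) simp
  ultimately obtain y z where "y \<in> I" "z \<in> I" "s = y * z" by blast
  then show ?case by (intro exI[of _ "1::nat"] conjI exI[of _ "\<lambda>_. y"] exI[of _ "\<lambda>_. z"]) auto
next
  case (diff s t)
  from diff.IH(1) obtain m y z where
    s: "m \<ge> 1" "\<forall>i\<in>{1..m::nat}. y i \<in> I \<and> z i \<in> I" "s = (\<Sum>i=1..m. y i * z i)" by blast
  from diff.IH(2) obtain n y' z' where
    t: "n \<ge> 1" "\<forall>i\<in>{1..n::nat}. y' i \<in> I \<and> z' i \<in> I" "t = (\<Sum>i=1..n. y' i * z' i)" by blast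
  \<comment> \<open>Concatenation of the two families; the minus sign goes into the left factors of
    the second one, which stay in \<open>I\<close>.\<close>
  define Y where "Y i = (if i \<le> m then y i else - y' (i - m))" for i
  define Z where "Z i = (if i \<le> m then z i else z' (i - m))" for i
  have "(\<Sum>i=1..m + n. Y i * Z i) = (\<Sum>i=1..m. Y i * Z i) + (\<Sum>i=m + 1..m + n. Y i * Z i)"
    by (rule sum.ub_add_nat) simp
  also have "(\<Sum>i=m + 1..m + n. Y i * Z i) = (\<Sum>i=1..n. Y (i + m) * Z (i + m))"
    by (subst sum.shift_bounds_cl_nat_ivl[symmetric]) (simp add: add.commute)
  also have "\<dots> = - t" by (simp add: t Y_def Z_def sum_negf)
  also have "(\<Sum>i=1..m. Y i * Z i) = s" by (simp add: s Y_def Z_def)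
  finally have "s - t = (\<Sum>i=1..m + n. Y i * Z i)" by simp
  moreover have "\<forall>i\<in>{1..m + n}. Y i \<in> I \<and> Z i \<in> I"
  proof
    fix i assume i: "i \<in> {1..m + n}"
    show "Y i \<in> I \<and> Z i \<in> I"
    proof (cases "i \<le> m")
      case False
      then have "i - m \<in> {1..n}" using i by auto
      then show ?thesis using t(2) False two_sided_idealD(5)[OF I] by (auto simp: Y_def Z_def)
    qed (use i s(2) in \<open>auto simp: Y_def Z_def\<close>)
  qed
  moreover have "1 \<le> m + n" using s(1) by simp
  ultimately show ?case by blast
qed

section \<open>Semiprime and idempotent ideals\<close>

lemma embed_ideal_mult:
  assumes "two_sided_ideal I" "u \<in> embed ` I"
  shows "embed a * u \<in> embed ` I" "u * embed a \<in> embed ` I"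
  using assms by (auto simp flip: embed_mult intro: two_sided_idealD)

lemma embed_ideal_add:
  assumes "two_sided_ideal I" "u \<in> embed ` I" "v \<in> embed ` I"
  shows "u + v \<in> embed ` I"
  using assms by (auto simp flip: embed_add intro: two_sided_idealD)

lemma embed_power_in_range: "1 \<le> n \<Longrightarrow> embed b ^ n \<in> range embed"
  by (simp add: range_embed_iff)

lemma embed_ideal_power_mono:
  assumes I: "two_sided_ideal I" and b: "embed b ^ m \<in> embed ` I" and mn: "m \<le> n"
  shows "embed b ^ n \<in> embed ` I"
  using mn
proof (induction n rule: dec_induct)
  case (step k)
  then show ?case using embed_ideal_mult(1)[OF I, of "embed b ^ k" b] by simp
qed (rule b)

definition cube_closed :: "'a::cstar_algebra set \<Rightarrow> bool" where
  "cube_closed I \<longleftrightarrow>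
    (\<forall>b. pos (embed b) \<longrightarrow> embed b ^ 4 \<in> embed ` I \<longrightarrow> embed b ^ 3 \<in> embed ` I)"

definition radical_closed :: "'a::cstar_algebra set \<Rightarrow> bool" where
  "radical_closed I \<longleftrightarrow>
    (\<forall>b N. pos (embed b) \<longrightarrow> 1 \<le> N \<longrightarrow> embed b ^ N \<in> embed ` I \<longrightarrow> b \<in> I)"

text \<open>If \<open>e\<^sup>p \<in> I\<close> with \<open>p > 9\<close> and \<open>j = \<lceil>p / 4\<rceil>\<close>, then \<open>e\<^bsup>4j\<^esup> \<in> I\<close>, hence \<open>e\<^bsup>3j\<^esup> \<in> I\<close>, and \<open>3j < p\<close>. The
  descent stops at 9, so the conclusion is obtained by starting from a ninth root.\<close>

lemma radical_closed_of_cube_closed: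
  fixes I :: "'a::cstar_algebra set"
  assumes I: "two_sided_ideal I" and Q: "cube_closed I"
  shows "radical_closed I"
  unfolding radical_closed_def
proof (intro allI impI)
  fix b :: 'a and N :: nat
  assume b: "pos (embed b)" and N: "1 \<le> N" and bN: "embed b ^ N \<in> embed ` I"
  obtain e where e: "pos (embed e)" "embed e ^ 9 = embed b" using pos_embed_root[OF b, of 9] by auto
  have "embed e ^ p \<in> embed ` I \<Longrightarrow> embed e ^ 9 \<in> embed ` I" for p
  proof (induction p rule: less_induct)
    case (less p)
    show ?case
    proof (cases "p \<le> 9")
      case True
      then show ?thesis using embed_ideal_power_mono[OF I less.prems] by blast
    next
      case False
      define j where "j = (p + 3) div 4"
      have j: "p \<le> 4 * j" "3 * j < p" "1 \<le> j" using False by (auto simp: j_def)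
      obtain f where f: "embed e ^ j = embed f" using embed_power_in_range[OF j(3), of e] by auto
      have "pos (embed f)" using pos_power[OF e(1), of j] f by simp
      moreover have "embed f ^ 4 \<in> embed ` I"
        using embed_ideal_power_mono[OF I less.prems j(1)] by (simp add: f[symmetric] power_mult[symmetric] mult.commute)
      ultimately have "embed f ^ 3 \<in> embed ` I" using Q by (simp add: cube_closed_def)
      then have "embed e ^ (3 * j) \<in> embed ` I" by (simp add: f[symmetric] power_mult[symmetric] mult.commute)
      then show ?thesis using less.IH j(2) by blast
    qed
  qed
  moreover have "embed e ^ (9 * N) \<in> embed ` I" using bN by (simp add: e(2)[symmetric] power_mult)
  ultimately have "embed e ^ 9 \<in> embed ` I" by blast
  then show "b \<in> I" by (auto simp: e(2))
qed

text \<open>The two conditions put the square of the ideal generated by \<open>c\<close> into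
  \<open>I\<close>; in the absence of a unit, \<open>c * c\<close> need not have the form
  \<open>c * y * c\<close>.\<close>

lemma semiprime_idealD:
  fixes c :: "'a::ring"
  assumes sp: "semiprime_ideal I" and cc: "c * c \<in> I" and cyc: "\<And>y. c * y * c \<in> I"
  shows "c \<in> I"
proof -
  have I: "two_sided_ideal I" using sp by (simp add: semiprime_ideal_def)
  define J where "J = \<Inter>{K. two_sided_ideal K \<and> c \<in> K}"
  have J: "two_sided_ideal J" unfolding J_def two_sided_ideal_def by auto
  \<comment> \<open>Two extensions in turn: \<open>K1\<close> fixes the right factor
    \<open>c\<close> and lets the left one range over \<open>J\<close>; \<open>K2\<close> then frees
    the right factor. The clauses with a middle \<open>y\<close> make \<open>K1\<close> and
    \<open>K2\<close> ideals.\<close>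
  define K1 where "K1 = {x. x * c \<in> I \<and> (\<forall>y. x * y * c \<in> I)}"
  have "two_sided_ideal K1"
    unfolding two_sided_ideal_def K1_def
  proof (intro conjI allI ballI CollectI)
    fix a x y assume "x \<in> {x. x * c \<in> I \<and> (\<forall>y. x * y * c \<in> I)}"
    then have *: "x * c \<in> I" "x * z * c \<in> I" for z by auto
    show "a * x * c \<in> I" using two_sided_idealD(3)[OF I *(1), of a] by (simp add: mult.assoc)
    show "a * x * y * c \<in> I" using two_sided_idealD(3)[OF I *(2)[of y], of a] by (simp add: mult.assoc)
    show "x * a * c \<in> I" by (rule *)
    show "x * a * y * c \<in> I" using *(2)[of "a * y"] by (simp add: mult.assoc)
  qed (use two_sided_idealD[OF I] in \<open>auto simp: left_diff_distrib\<close>)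
  then have JK1: "J \<subseteq> K1" using cc cyc by (auto simp: J_def K1_def)
  define K2 where "K2 = {w. \<forall>x\<in>J. x * w \<in> I \<and> (\<forall>y. x * y * w \<in> I)}"
  have "two_sided_ideal K2"
    unfolding two_sided_ideal_def K2_def
  proof (intro conjI allI ballI CollectI)
    fix a w x y assume w: "w \<in> {w. \<forall>x\<in>J. x * w \<in> I \<and> (\<forall>y. x * y * w \<in> I)}" and x: "x \<in> J"
    then have *: "x * w \<in> I" "x * z * w \<in> I" for z by auto
    show "x * (a * w) \<in> I" using *(2)[of a] by (simp add: mult.assoc)
    show "x * y * (a * w) \<in> I" using *(2)[of "y * a"] by (simp add: mult.assoc)
    show "x * (w * a) \<in> I" using two_sided_idealD(4)[OF I *(1), of a] by (simp add: mult.assoc)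
    show "x * y * (w * a) \<in> I" using two_sided_idealD(4)[OF I *(2)[of y], of a] by (simp add: mult.assoc)
  qed (use two_sided_idealD[OF I] in \<open>auto simp: right_diff_distrib\<close>)
  moreover have "c \<in> K2" using JK1 by (auto simp: K1_def K2_def)
  ultimately have "J \<subseteq> K2" unfolding J_def by (intro Inter_lower) simp
  then have "{y * z | y z. y \<in> J \<and> z \<in> J} \<subseteq> I" by (auto simp: K2_def)
  then have "ideal_power J 2 \<subseteq> I" unfolding ideal_power_2 by (rule group_closure_subset_ideal[OF I])
  then have "J \<subseteq> I" using sp J by (simp add: semiprime_ideal_def)
  then show ?thesis by (auto simp: J_def)
qed

lemma cube_closed_of_semiprime:
  fixes I :: "'a::cstar_algebra set"
  assumes sp: "semiprime_ideal I"
  shows "cube_closed I"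
  unfolding cube_closed_def
proof (intro allI impI)
  fix b :: 'a assume b: "pos (embed b)" and b4: "embed b ^ 4 \<in> embed ` I"
  have I: "two_sided_ideal I" using sp by (simp add: semiprime_ideal_def)
  obtain c where c: "embed b ^ 3 = embed c" using embed_power_in_range[of 3 b] by auto
  have "c \<in> I"
  proof (rule semiprime_idealD[OF sp])
    \<comment> \<open>\<open>c * c = b^6\<close> is a multiple of \<open>b^4\<close>, and the
      sandwich between two factors \<open>b^3\<close> is covered since
      \<open>3 + 3 > 4\<close>.\<close>
    have "embed (c * c) = embed b ^ 6" by (simp add: embed_mult c[symmetric] power_add[symmetric])
    also have "\<dots> \<in> embed ` I" by (rule embed_ideal_power_mono[OF I b4]) simp
    finally show "c * c \<in> I" by auto
    fix x
    obtain y y' where "embed b ^ 3 * embed x * embed b ^ 3 = embed b ^ 4 * embed y + embed y' * embed b ^ 4"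
      using sandwich_decomposition[OF b, of 4 3 3 x] by auto
    then have "embed (c * x * c) = embed b ^ 4 * embed y + embed y' * embed b ^ 4"
      by (simp add: embed_mult c)
    also have "\<dots> \<in> embed ` I" by (intro embed_ideal_add embed_ideal_mult I b4)
    finally show "c * x * c \<in> I" by auto
  qed
  then show "embed b ^ 3 \<in> embed ` I" by (simp add: c)
qed

section \<open>Idempotent ideals are self-adjoint and closed under roots\<close>

lemma two_sided_ideal_adj_preimage:
  fixes I :: "'a::cstar_algebra set"
  assumes "two_sided_ideal I"
  shows "two_sided_ideal {x. adj x \<in> I}"
  unfolding two_sided_ideal_def using two_sided_idealD[OF assms] by (auto simp: adj_diff adj_mult)

text \<open>Each factor is a left multiple of a power of \<open>c\<close> with exponent just below
  1/2, and each sandwich adds exponents with a small loss. Two factors would stay below exponent 1,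
  three reach it, and multiples of the self-adjoint \<open>c\<close> have their adjoints in
  \<open>I\<close>.\<close>

lemma adj_mult3_in_ideal:
  fixes I :: "'a::cstar_algebra set"
  assumes I: "two_sided_ideal I" and pqr: "p \<in> I" "q \<in> I" "r \<in> I"
  shows "adj (p * q * r) \<in> I"
proof -
  define z where "z i = (if i = 0 then p else if i = 1 then q else r)" for i :: nat
  define c where "c = (\<Sum>j\<in>{0,1,2}. adj (z j) * z j)"
  have cI: "c \<in> I"
    unfolding c_def by (intro two_sided_ideal_sum[OF I]) (auto simp: z_def intro: two_sided_idealD[OF I] pqr)
  have "pos (embed c)" unfolding c_def by (rule pos_embed_sum_squares)
  \<comment> \<open>Exponents refer to \<open>d^10\<close>, a scalar multiple of \<open>c\<close>:
    the factors lie in \<open>A d^4\<close> since \<open>4 < 5\<close>, and the sandwiches use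
    \<open>7 < 4 + 4\<close> and \<open>10 < 7 + 4\<close>.\<close>
  then obtain d \<epsilon> where d: "0 < \<epsilon>" "pos (embed d)" "norm (embed d) \<le> 1" "embed d ^ 10 = \<epsilon> *\<^sub>R embed c"
    using pos_embed_contractive_root[OF _ one_le_numeral] by metis
  have fac: "\<exists>v. embed (z i) = embed v * embed d ^ 4" if "i \<in> {0,1,2}" for i
  proof (rule right_factor_power[OF d(2)])
    show "norm (embed (z i) * s) \<le> sqrt (inverse \<epsilon>) * norm (embed d ^ 5 * s)" for s
      using norm_embed_mult_le_of_sum_squares[OF _ that d(1,2), of 5 z s] d(4) by (simp add: c_def)
  qed (use d in auto)
  obtain v1 v2 v3 where v: "embed p = embed v1 * embed d ^ 4" "embed q = embed v2 * embed d ^ 4"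
    "embed r = embed v3 * embed d ^ 4"
    using fac[of 0] fac[of 1] fac[of 2] by (auto simp: z_def)
  define T where "T = {x. adj x \<in> I}"
  have T: "two_sided_ideal T" unfolding T_def by (rule two_sided_ideal_adj_preimage[OF I])
  have "adj (embed c) = embed c" using \<open>pos (embed c)\<close> by (rule pos_adj)
  then have "adj c = c" by (simp flip: embed_adj)
  then have "c \<in> T" using cI by (simp add: T_def)
  have dT: "embed d ^ 10 * embed y \<in> embed ` T" "embed y * embed d ^ 10 \<in> embed ` T" for y
  proof -
    \<comment> \<open>The scalar \<open>\<epsilon>\<close> is moved onto \<open>y\<close>, since
      \<open>T\<close> need not be closed under scalars.\<close>
    have e: "embed d ^ 10 * embed y = embed (c * (\<epsilon> *\<^sub>R y))"
      "embed y * embed d ^ 10 = embed ((\<epsilon> *\<^sub>R y) * c)"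
      by (simp_all add: d(4) embed_mult embed_scaleR)
    show "embed d ^ 10 * embed y \<in> embed ` T" "embed y * embed d ^ 10 \<in> embed ` T"
      unfolding e using two_sided_idealD(3,4)[OF T \<open>c \<in> T\<close>] by blast+
  qed
  have d74: "embed d ^ 7 * embed y * embed d ^ 4 \<in> embed ` T" for y
  proof -
    obtain y1 y2 where "embed d ^ 7 * embed y * embed d ^ 4 = embed d ^ 10 * embed y1 + embed y2 * embed d ^ 10"
      using sandwich_decomposition[OF d(2), of 10 7 4 y] by auto
    then show ?thesis using embed_ideal_add[OF T dT] by simp
  qed
  obtain y1 y2 where y: "embed d ^ 4 * embed v2 * embed d ^ 4 = embed d ^ 7 * embed y1 + embed y2 * embed d ^ 7"
    using sandwich_decomposition[OF d(2), of 7 4 4 v2] by auto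
  have "embed (p * q * r) = embed v1 * (embed d ^ 4 * embed v2 * embed d ^ 4) * embed v3 * embed d ^ 4"
    by (simp add: embed_mult v mult.assoc)
  also have "\<dots> = embed v1 * (embed d ^ 7 * embed (y1 * v3) * embed d ^ 4) +
      embed v1 * (embed y2 * (embed d ^ 7 * embed v3 * embed d ^ 4))"
    unfolding y by (simp add: embed_mult mult.assoc distrib_left distrib_right)
  also have "\<dots> \<in> embed ` T" by (intro embed_ideal_add embed_ideal_mult T d74)
  finally show ?thesis by (auto simp: T_def)
qed

text \<open>Applying \<open>I = I^2\<close> twice shows that \<open>I\<close> is additively
  generated by threefold products.\<close>

lemma adj_in_idempotent_ideal:
  fixes I :: "'a::cstar_algebra set"
  assumes I: "two_sided_ideal I" and idem: "ideal_power I 2 = I" and x: "x \<in> I"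
  shows "adj x \<in> I"
proof -
  define T where "T = {x. adj x \<in> I}"
  have T: "two_sided_ideal T" unfolding T_def by (rule two_sided_ideal_adj_preimage[OF I])
  have *: "y * r \<in> T" if y: "y \<in> I" and r: "r \<in> I" for y r
  proof -
    have "y \<in> group_closure {p * q | p q. p \<in> I \<and> q \<in> I}" using y idem by (simp add: ideal_power_2)
    then show ?thesis
    proof induction
      case (base s)
      then show ?case using adj_mult3_in_ideal[OF I _ _ r] two_sided_idealD(1)[OF T] by (auto simp: T_def)
    next
      case (diff s t)
      then show ?case using two_sided_idealD(2)[OF T] by (simp add: left_diff_distrib)
    qed
  qed
  have "x \<in> group_closure {p * q | p q. p \<in> I \<and> q \<in> I}" using x idem by (simp add: ideal_power_2)
  also have "\<dots> \<subseteq> T" by (rule group_closure_subset_ideal[OF T]) (use * in auto)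
  finally show ?thesis by (simp add: T_def)
qed

lemma cube_closed_of_idempotent:
  fixes I :: "'a::cstar_algebra set"
  assumes I: "two_sided_ideal I" and idem: "ideal_power I 2 = I"
  shows "cube_closed I"
  unfolding cube_closed_def
proof (intro allI impI)
  fix b :: 'a assume b: "pos (embed b)" and "embed b ^ 4 \<in> embed ` I"
  then obtain a where a: "a \<in> I" "embed b ^ 4 = embed a" by auto
  have "a \<in> group_closure {y * z | y z. y \<in> I \<and> z \<in> I}" using a(1) idem by (simp add: ideal_power_2)
  from group_closure_products_sum[OF I this] obtain n y z where
    yz: "\<forall>i\<in>{1..n::nat}. y i \<in> I \<and> z i \<in> I" "a = (\<Sum>i=1..n. y i * z i)" by blast
  \<comment> \<open>The disjoint union indexes the elements \<open>adj (y i)\<close> and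
    \<open>z i\<close>; the former lie in \<open>I\<close> because an idempotent ideal is
    self-adjoint.\<close>
  define S where "S = {1..n} <+> {1..n}"
  define w where "w = case_sum (\<lambda>i. adj (y i)) z"
  have S: "finite S" by (simp add: S_def)
  have wI: "w j \<in> I" if "j \<in> S" for j
    using that yz adj_in_idempotent_ideal[OF I idem] by (auto simp: S_def w_def)
  define h where "h = (\<Sum>j\<in>S. adj (w j) * w j)"
  have "pos (embed h)" unfolding h_def by (rule pos_embed_sum_squares)
  then obtain g \<epsilon> where g: "0 < \<epsilon>" "pos (embed g)" "norm (embed g) \<le> 1" "embed g ^ 12 = \<epsilon> *\<^sub>R embed h"
    using pos_embed_contractive_root[OF _ one_le_numeral] by metis
  define C where "C = sqrt (inverse \<epsilon>)"
  have C: "0 \<le> C" using g(1) by (simp add: C_def)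
  have w: "norm (embed (w j) * s) \<le> C * norm (embed g ^ 6 * s)" if "j \<in> S" for j s
    using norm_embed_mult_le_of_sum_squares[OF S that g(1,2), of 6 w s] g(4) by (simp add: h_def C_def)
  obtain b2 where b2: "embed b ^ 2 = embed b2" using embed_power_in_range[of 2 b] by auto
  define D where "D = sqrt (real n) * C"
  have D: "0 \<le> D" using C by (simp add: D_def)
  \<comment> \<open>Compressing \<open>b^4\<close> by \<open>s\<close> gives \<open>n\<close>
    products, each bounded by the square of \<open>C * norm (embed g ^ 6 * s)\<close>; taking the
    square root explains the constant \<open>D\<close>.\<close>
  have b2s: "norm (embed b ^ 2 * s) \<le> D * norm (embed g ^ 6 * s)" for s
  proof (rule power2_le_imp_le)
    have "(norm (embed b ^ 2 * s))\<^sup>2 = norm (adj (embed b ^ 2 * s) * (embed b ^ 2 * s))"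
      by (simp add: cstar_identity)
    also have "adj (embed b ^ 2 * s) * (embed b ^ 2 * s) = adj s * embed b ^ 4 * s"
      by (simp add: adj_mult adj_power pos_adj[OF b] mult.assoc power_add[symmetric] flip: mult.assoc[of "embed b ^ 2"])
    also have "\<dots> = (\<Sum>i=1..n. adj (embed (w (Inl i)) * s) * (embed (w (Inr i)) * s))"
      by (simp add: a(2) yz(2) embed_sum embed_mult embed_adj adj_mult adj_adj w_def sum_distrib_left
          sum_distrib_right mult.assoc)
    also have "norm \<dots> \<le> (\<Sum>i=1..n. (C * norm (embed g ^ 6 * s)) * (C * norm (embed g ^ 6 * s)))"
    proof (rule sum_norm_le)
      fix i assume "i \<in> {1..n}"
      then have i: "Inl i \<in> S" "Inr i \<in> S" by (auto simp: S_def)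
      have "norm (adj (embed (w (Inl i)) * s)) \<le> C * norm (embed g ^ 6 * s)"
        using w[OF i(1)] by (simp add: norm_adj)
      from mult_mono[OF this w[OF i(2), of s]] C
      show "norm (adj (embed (w (Inl i)) * s) * (embed (w (Inr i)) * s)) \<le>
          (C * norm (embed g ^ 6 * s)) * (C * norm (embed g ^ 6 * s))"
        by (intro order_trans[OF norm_mult_ineq]) simp
    qed
    also have "\<dots> = (D * norm (embed g ^ 6 * s))\<^sup>2" by (simp add: D_def power2_eq_square)
    finally show "(norm (embed b ^ 2 * s))\<^sup>2 \<le> (D * norm (embed g ^ 6 * s))\<^sup>2" .
  qed (simp add: D)
  obtain v where v: "embed b ^ 2 = embed v * embed g ^ 5"
    using right_factor_power[OF g(2), of b2 D 6 5] b2s D by (auto simp: b2)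
  \<comment> \<open>For \<open>s = (1 - g^2)^k\<close>, a contraction, the squared norm of
    \<open>b s\<close> is at most the norm of \<open>b^2 s\<close>, which is of order
    \<open>k^(-3)\<close>. After the square root the exponent \<open>-3/2\<close> is still
    summable.\<close>
  obtain v' where v': "embed b = embed v' * embed g ^ 2"
  proof -
    have "norm (embed b * (1 - embed g ^ 2) ^ k) \<le> sqrt (65 * D) * real k powr (- (3 / 2))"
      if k: "1 \<le> k" for k
    proof (rule power2_le_imp_le)
      define s where "s = (1 - embed g ^ 2) ^ k"
      have "(norm (embed b * s))\<^sup>2 = norm (adj (embed b * s) * (embed b * s))" by (simp add: cstar_identity)
      also have "adj (embed b * s) * (embed b * s) = adj s * (embed b ^ 2 * s)"
        by (simp add: adj_mult pos_adj[OF b] mult.assoc power2_eq_square)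
      also have "norm \<dots> \<le> 1 * (D * norm (embed g ^ 6 * s))"
        using norm_one_minus_power_le[OF g(2,3), of 2 k]
        by (intro order_trans[OF norm_mult_ineq] mult_mono b2s) (simp_all add: norm_adj s_def)
      also have "\<dots> \<le> 1 * (D * (65 * real k powr (- (real 6 / real 2))))"
        unfolding s_def using k D
        by (intro mult_left_mono norm_power_mult_one_minus_le[OF g(2,3)]) auto
      also have "real k powr (- (real 6 / real 2)) = (real k powr (- (3 / 2)))\<^sup>2"
        using k by (simp add: power2_eq_square flip: powr_add)
      finally show "(norm (embed b * (1 - embed g ^ 2) ^ k))\<^sup>2 \<le> (sqrt (65 * D) * real k powr (- (3 / 2)))\<^sup>2"
        using D by (simp add: s_def power_mult_distrib mult_ac)
    qed (simp add: D)
    from right_factor_power_of_decay[OF this] show thesis using that by auto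
  qed
  \<comment> \<open>Partial sums of the geometric series for the inverse of \<open>g^5\<close>;
    formally, \<open>f j\<close> is \<open>w j\<close> divided by \<open>g^5\<close>.\<close>
  define W where "W N = (\<Sum>k<N. (1 - embed g ^ 5) ^ k)" for N
  have "\<exists>f. (\<lambda>N. embed (w j) * W N) \<longlonglongrightarrow> embed f" if "j \<in> S" for j
    using right_factor_power_contraction[OF g(2,3) w[OF that], of 5] C by (auto simp: W_def)
  then obtain f where f: "\<And>j. j \<in> S \<Longrightarrow> (\<lambda>N. embed (w j) * W N) \<longlonglongrightarrow> embed (f j)" by metis
  \<comment> \<open>\<open>W N * h\<close> is read in two ways: as the sum of
    \<open>adj (w j * W N) * w j\<close>, whose limit has right factors \<open>w j\<close> in
    \<open>I\<close>, and as a multiple of \<open>W N * g^12\<close>, which tends to the same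
    multiple of \<open>g^7\<close>.\<close>
  have g7: "(\<Sum>j\<in>S. embed (adj (f j) * w j)) = inverse \<epsilon> *\<^sub>R embed g ^ 7"
  proof (rule LIMSEQ_unique)
    show "(\<lambda>N. \<Sum>j\<in>S. adj (embed (w j) * W N) * embed (w j)) \<longlonglongrightarrow> (\<Sum>j\<in>S. embed (adj (f j) * w j))"
      unfolding embed_mult embed_adj
      by (intro tendsto_sum tendsto_mult tendsto_const bounded_linear.tendsto[OF bounded_linear_adj] f)
    have Wadj: "adj (W N) = W N" for N
      by (simp add: W_def adj_sum adj_power adj_diff pos_adj[OF g(2)])
    have Wg: "W N * embed g ^ 12 = embed g ^ 7 - embed g ^ 7 * (1 - embed g ^ 5) ^ N" for N
    proof -
      have "W N * embed g ^ 12 = (W N * (1 - (1 - embed g ^ 5))) * embed g ^ 7"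
        by (simp add: mult.assoc flip: power_add)
      also have "\<dots> = (1 - (1 - embed g ^ 5) ^ N) * embed g ^ 7"
        unfolding W_def geometric_telescope ..
      also have "(1 - embed g ^ 5) ^ N * embed g ^ 7 = embed g ^ 7 * (1 - embed g ^ 5) ^ N"
        by (rule power_commute_one_minus)
      then have "(1 - (1 - embed g ^ 5) ^ N) * embed g ^ 7 = embed g ^ 7 - embed g ^ 7 * (1 - embed g ^ 5) ^ N"
        by (simp add: left_diff_distrib)
      finally show ?thesis .
    qed
    have "(\<Sum>j\<in>S. adj (embed (w j) * W N) * embed (w j)) = W N * embed h" for N
      by (simp add: h_def embed_sum embed_mult embed_adj adj_mult Wadj sum_distrib_left mult.assoc)
    moreover have "embed h = inverse \<epsilon> *\<^sub>R embed g ^ 12" using g(1,4) by simp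
    ultimately have e: "(\<Sum>j\<in>S. adj (embed (w j) * W N) * embed (w j)) =
        inverse \<epsilon> *\<^sub>R (embed g ^ 7 - embed g ^ 7 * (1 - embed g ^ 5) ^ N)" for N
      by (simp add: Wg)
    have "summable (\<lambda>N. embed g ^ 7 * (1 - embed g ^ 5) ^ N)"
      by (rule summable_of_powr_bound[OF norm_power_mult_one_minus_le[OF g(2,3)]]) auto
    then have "(\<lambda>N. embed g ^ 7 * (1 - embed g ^ 5) ^ N) \<longlonglongrightarrow> 0" by (rule summable_LIMSEQ_zero)
    then have "(\<lambda>N. inverse \<epsilon> *\<^sub>R (embed g ^ 7 - embed g ^ 7 * (1 - embed g ^ 5) ^ N)) \<longlonglongrightarrow>
        inverse \<epsilon> *\<^sub>R (embed g ^ 7 - 0)" by (intro tendsto_intros)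
    then show "(\<lambda>N. \<Sum>j\<in>S. adj (embed (w j) * W N) * embed (w j)) \<longlonglongrightarrow> inverse \<epsilon> *\<^sub>R embed g ^ 7"
      unfolding e by simp
  qed
  have "embed b ^ 3 = embed b ^ 2 * adj (embed b)"
    by (simp add: pos_adj[OF b] flip: power_Suc2)
  also have "\<dots> = embed v * embed g ^ 5 * (embed g ^ 2 * adj (embed v'))"
    unfolding v by (subst v') (simp add: adj_mult adj_power pos_adj[OF g(2)])
  also have "\<dots> = embed v * embed g ^ 7 * embed (adj v')"
    by (simp add: embed_adj mult.assoc)
  also have "embed g ^ 7 = \<epsilon> *\<^sub>R (\<Sum>j\<in>S. embed (adj (f j) * w j))" using g(1) by (simp add: g7)
  \<comment> \<open>The scalar \<open>\<epsilon>\<close> is attached to the left factor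
    \<open>v * adj (f j)\<close>, leaving \<open>w j\<close> in \<open>I\<close> untouched.\<close>
  also have "embed v * (\<epsilon> *\<^sub>R (\<Sum>j\<in>S. embed (adj (f j) * w j))) * embed (adj v') =
      embed (\<Sum>j\<in>S. (\<epsilon> *\<^sub>R (v * adj (f j))) * w j * adj v')"
    by (simp add: embed_sum embed_mult embed_scaleR scaleR_sum_right sum_distrib_left sum_distrib_right mult.assoc)
  also have "\<dots> \<in> embed ` I"
    using wI by (intro imageI two_sided_ideal_sum[OF I] two_sided_idealD(3,4)[OF I])
  finally show "embed b ^ 3 \<in> embed ` I" .
qed

section \<open>Factorization and the equivalences\<close>

lemma radical_closed_factorization:
  fixes I :: "'a::cstar_algebra set"
  assumes R: "radical_closed I" and N: "1 \<le> N" and x: "embed (adj x * x) ^ N \<in> embed ` I" and I: "two_sided_ideal I"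
  shows "\<exists>y\<in>I. \<exists>z\<in>I. x = y * z"
proof -
  have "pos (embed (adj x * x))" by (simp add: embed_mult embed_adj pos_adj_mult_self)
  \<comment> \<open>With an eighth root, \<open>x\<close> is dominated by \<open>b^4\<close>, so
    \<open>b^2\<close> can be divided out, which leaves one \<open>b\<close> for each
    factor.\<close>
  then obtain b where b: "pos (embed b)" "embed b ^ 8 = embed (adj x * x)"
    using pos_embed_root[of "adj x * x" 8] by auto
  have "embed b ^ (8 * N) \<in> embed ` I" using x by (simp add: power_mult b(2))
  then have "b \<in> I" using R b(1) N by (auto simp: radical_closed_def dest!: spec[of _ b] spec[of _ "8 * N"])
  have "norm (embed x * s) \<le> 1 * norm (embed b ^ 4 * s)" for s
    using norm_embed_mult_le_of_sum_squares[of "{()}" "()" 1 b 4 "\<lambda>_. x" s] b by simp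
  from right_factor_power[OF b(1) this, of 2] obtain v where "embed x = embed v * embed b ^ 2" by auto
  then have "embed x = embed ((v * b) * b)" by (simp add: embed_mult power2_eq_square mult.assoc)
  then have "x = (v * b) * b" by simp
  moreover have "v * b \<in> I" using \<open>b \<in> I\<close> two_sided_idealD(3)[OF I] by blast
  ultimately show ?thesis using \<open>b \<in> I\<close> by blast
qed

text \<open>For \<open>x\<close> in \<open>J\<close>, the square of \<open>adj x * x\<close> lies in
  \<open>I\<close>, and radical closure then factors \<open>x\<close> within
  \<open>I\<close>.\<close>

lemma semiprime_of_radical_closed:
  fixes I :: "'a::cstar_algebra set"
  assumes I: "two_sided_ideal I" and R: "radical_closed I"
  shows "semiprime_ideal I"
  unfolding semiprime_ideal_def
proof (intro conjI allI impI subsetI)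
  fix J and x :: 'a assume J: "two_sided_ideal J" "ideal_power J 2 \<subseteq> I" and x: "x \<in> J"
  have "adj x * x \<in> J" using two_sided_idealD(3)[OF J(1) x] .
  then have "(adj x * x) * (adj x * x) \<in> ideal_power J 2"
    unfolding ideal_power_2 by (intro group_closure.base insertI2) blast
  then have "embed (adj x * x) ^ 2 \<in> embed ` I" using J(2) by (auto simp: power2_eq_square simp flip: embed_mult)
  then obtain y z where "y \<in> I" "z \<in> I" "x = y * z"
    using radical_closed_factorization[OF R _ _ I, of 2 x] by auto
  then show "x \<in> I" using two_sided_idealD(3)[OF I] by blast
qed (rule I)

text \<open>The idempotent case applies to \<open>K = I^m\<close>; if \<open>b^N\<close> lies in
  \<open>I\<close>, then its \<open>m\<close>-th power lies in \<open>K\<close>.\<close>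

lemma radical_closed_of_ideal_power_eq:
  fixes I :: "'a::cstar_algebra set"
  assumes I: "two_sided_ideal I" and mn: "1 \<le> m" "m < n" and eq: "ideal_power I m = ideal_power I n"
  shows "radical_closed I"
  unfolding radical_closed_def
proof (intro allI impI)
  fix b :: 'a and N :: nat
  assume b: "pos (embed b)" and N: "1 \<le> N" and "embed b ^ N \<in> embed ` I"
  then obtain a where a: "a \<in> I" "embed b ^ N = embed a" by auto
  define K where "K = ideal_power I m"
  have K: "two_sided_ideal K" unfolding K_def by (rule two_sided_ideal_ideal_power[OF I mn(1)])
  have "K \<subseteq> ideal_power K 2"
    using ideal_power_stabilises[OF I mn eq] ideal_power_add_subset[OF mn(1) mn(1), of I]
    by (simp add: K_def ideal_power_2)
  moreover have "ideal_power K 2 \<subseteq> K"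
    unfolding ideal_power_2 by (rule group_closure_subset_ideal[OF K]) (auto intro: two_sided_idealD[OF K])
  ultimately have RK: "radical_closed K"
    by (intro radical_closed_of_cube_closed cube_closed_of_idempotent K) auto
  have "nonempty_prod (replicate m a) \<in> K"
    unfolding K_def by (rule nonempty_prod_in_ideal_power) (use a in auto)
  moreover have "embed (nonempty_prod (replicate m a)) = embed b ^ (N * m)"
    using embed_nonempty_prod_replicate[OF mn(1), of a] by (simp add: a(2)[symmetric] power_mult)
  ultimately have "embed b ^ (N * m) \<in> embed ` K" by (metis imageI)
  then have "b \<in> K" using RK b N mn(1) unfolding radical_closed_def by (metis mult_le_mono nat_mult_1)
  then show "b \<in> I"
    using ideal_power_antimono[OF I _ mn(1)] ideal_power_1[OF I] by (auto simp: K_def)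
qed

lemma radical_closed_of_square_roots:
  fixes I :: "'a::cstar_algebra set"
  assumes I: "two_sided_ideal I" and sq: "\<forall>a \<in> I \<inter> positive_elements. positive_root 2 a \<in> I"
  shows "radical_closed I"
  unfolding radical_closed_def
proof (intro allI impI)
  fix b :: 'a and N :: nat
  assume b: "pos (embed b)" and N: "1 \<le> N" and bN: "embed b ^ N \<in> embed ` I"
  \<comment> \<open>Descent along powers of two: \<open>b^(2^k)\<close> is the positive square root
    of \<open>b^(2^(k+1))\<close>. It starts at \<open>2^N\<close>, which exceeds
    \<open>N\<close>.\<close>
  have "embed b ^ 2 ^ k \<in> embed ` I \<Longrightarrow> embed b \<in> embed ` I" for k
  proof (induction k)
    case (Suc k)
    obtain c where c: "embed b ^ 2 ^ k = embed c" using embed_power_in_range[of "2 ^ k" b] by auto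
    obtain a where a: "a \<in> I" "embed b ^ 2 ^ Suc k = embed a" using Suc.prems by auto
    have "pos (embed c)" "pos (embed a)" using pos_power[OF b] c a(2) by metis+
    moreover have "embed c ^ 2 = embed a" by (simp add: c[symmetric] a(2)[symmetric] power_mult[symmetric] mult.commute)
    ultimately have "positive_root 2 a = c" by (intro positive_root_eqI) auto
    moreover have "a \<in> I \<inter> positive_elements" using a(1) \<open>pos (embed a)\<close> by (simp add: positive_elements_iff)
    ultimately have "c \<in> I" using sq by auto
    then show ?case using Suc.IH c by auto
  qed simp
  moreover have "embed b ^ 2 ^ N \<in> embed ` I"
    by (rule embed_ideal_power_mono[OF I bN]) (simp add: less_imp_le)
  ultimately have "embed b \<in> embed ` I" by blast
  then show "b \<in> I" by auto
qed

lemma positive_root_in_radical_closed: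
  assumes R: "radical_closed I" and a: "a \<in> I \<inter> positive_elements" and n: "1 \<le> n"
  shows "positive_root n a \<in> I"
proof -
  have "pos (embed a)" using a by (simp add: positive_elements_iff)
  then obtain b where b: "pos (embed b)" "embed b ^ n = embed a" using pos_embed_root n by blast
  then have "embed b ^ n \<in> embed ` I" using a by simp
  then have "b \<in> I" using R b(1) n unfolding radical_closed_def by blast
  then show ?thesis using positive_root_eqI[OF b(1) n b(2)] by simp
qed

theorem theoremA:
  fixes I :: "'a::cstar_algebra set"
  assumes "two_sided_ideal I"
  shows "(semiprime_ideal I \<longleftrightarrow> ideal_power I 2 = I)
    \<and> (semiprime_ideal I \<longleftrightarrow>
        (\<forall>x\<in>I. \<exists>n\<ge>1. \<exists>y z :: nat \<Rightarrow> 'a.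
           (\<forall>i\<in>{1..n}. y i \<in> I \<and> z i \<in> I) \<and> x = (\<Sum>i=1..n. y i * z i)))
    \<and> (semiprime_ideal I \<longleftrightarrow>
        (\<exists>m n. m \<ge> 1 \<and> n \<ge> 1 \<and> m \<noteq> n \<and> ideal_power I m = ideal_power I n))
    \<and> (semiprime_ideal I \<longleftrightarrow> (\<forall>x\<in>I. \<exists>y\<in>I. \<exists>z\<in>I. x = y * z))
    \<and> (semiprime_ideal I \<longleftrightarrow>
        (\<forall>a \<in> I \<inter> positive_elements. positive_root 2 a \<in> I))
    \<and> (semiprime_ideal I \<longleftrightarrow>
        (\<forall>a \<in> I \<inter> positive_elements. \<forall>n\<ge>1. positive_root n a \<in> I))"
    (is "(?sp \<longleftrightarrow> ?idem) \<and> (?sp \<longleftrightarrow> ?sums) \<and> (?sp \<longleftrightarrow> ?pow) \<and> (?sp \<longleftrightarrow> ?fac) \<and> (?sp \<longleftrightarrow> ?sqrt) \<and>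
      (?sp \<longleftrightarrow> ?roots)")
proof -
  note I = assms
  \<comment> \<open>Two cycles pass through \<open>radical_closed\<close>: factorization, sums of
    products, idempotence, equal powers and back; arbitrary roots, square roots and back.\<close>
  have sp: "?sp \<longleftrightarrow> radical_closed I"
    using radical_closed_of_cube_closed[OF I] cube_closed_of_semiprime semiprime_of_radical_closed[OF I] by blast
  have fac: "?fac" if "radical_closed I"
  proof
    fix x assume "x \<in> I"
    then have "embed (adj x * x) ^ 1 \<in> embed ` I" using two_sided_idealD(3)[OF I] by simp
    then show "\<exists>y\<in>I. \<exists>z\<in>I. x = y * z" using radical_closed_factorization[OF that _ _ I] by blast
  qed
  have sums: "?sums" if "?fac"
  proof
    fix x assume "x \<in> I"
    with that obtain y z where "y \<in> I" "z \<in> I" "x = y * z" by blast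
    then show "\<exists>n\<ge>1. \<exists>y z :: nat \<Rightarrow> 'a. (\<forall>i\<in>{1..n}. y i \<in> I \<and> z i \<in> I) \<and> x = (\<Sum>i=1..n. y i * z i)"
      by (intro exI[of _ "1::nat"] conjI exI[of _ "\<lambda>_. y"] exI[of _ "\<lambda>_. z"]) auto
  qed
  have idem: "?idem" if "?sums"
  proof
    show "ideal_power I 2 \<subseteq> I"
      unfolding ideal_power_2 by (rule group_closure_subset_ideal[OF I]) (auto intro: two_sided_idealD[OF I])
    have "two_sided_ideal (ideal_power I 2)" by (rule two_sided_ideal_ideal_power[OF I]) simp
    show "I \<subseteq> ideal_power I 2"
    proof
      fix x assume "x \<in> I"
      with that obtain n and y z :: "nat \<Rightarrow> 'a" where
        yz: "\<forall>i\<in>{1..n}. y i \<in> I \<and> z i \<in> I" and x: "x = (\<Sum>i=1..n. y i * z i)" by blast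
      have "y i * z i \<in> ideal_power I 2" if "i \<in> {1..n}" for i
        unfolding ideal_power_2 using that yz by (intro group_closure.base insertI2) blast
      then show "x \<in> ideal_power I 2"
        unfolding x by (rule two_sided_ideal_sum[OF \<open>two_sided_ideal (ideal_power I 2)\<close>])
    qed
  qed
  have pow: "?pow" if "?idem"
    using that ideal_power_1[OF I] by (intro exI[of _ 2] exI[of _ 1]) simp
  have "radical_closed I" if "?pow"
  proof -
    from that obtain m n where mn: "m \<ge> 1" "n \<ge> 1" "m \<noteq> n" "ideal_power I m = ideal_power I n" by blast
    show ?thesis
    proof (cases "m < n")
      case True
      then show ?thesis using radical_closed_of_ideal_power_eq[OF I mn(1) _ mn(4)] by blast
    next
      case False
      then show ?thesis using radical_closed_of_ideal_power_eq[OF I mn(2) _ mn(4)[symmetric]] mn(3) by simp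
    qed
  qed
  moreover have "?roots" if "radical_closed I"
    using positive_root_in_radical_closed[OF that] by blast
  moreover have "?sqrt" if "?roots" using that by auto
  moreover have "radical_closed I" if "?sqrt" by (rule radical_closed_of_square_roots[OF I that])
  ultimately show ?thesis using sp fac sums idem pow by argo
qed

end
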